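(* Let $R$ be a non-trivial commutative ring (i.e. $1\neq 0$ in $R$). Then the free differential algebra modality $\mathsf{Diff}$ on the category $\mathsf{MOD}_R$ of $R$-modules does not admit a deriving transformation; that is, there is no natural transformation $\mathsf{b}:\mathsf{Diff}(M)\to\mathsf{Diff}(M)\otimes M$ which is a deriving transformation for the algebra modality $(\mathsf{Diff},\nu,\alpha,\nabla,u)$.
   Context: Composition is in diagrammatic order ($fg$ means first $f$, then $g$). $\otimes$ is the tensor product over $R$, with symmetry $\sigma$; associators and unitors are suppressed. An algebra modality on $\mathsf{MOD}_R$ (the dual of a coalgebra modality, i.e. a coalgebra modality on $\mathsf{MOD}_R^{op}$) is a monad $(T,\nu,\alpha)$, $\nu:TTM\to TM$, $\alpha:M\to TM$, with natural transformations $\nabla:TM\otimes TM\to TM$, $u:R\to TM$ making each $TM$ a commutative $R$-algebra such that $\nu$ is compatible with multiplication: $\nabla\nu=(\nu\otimes\nu)\nabla$. A deriving transformation for it is a natural transformation $\mathsf{b}:TM\to TM\otimes M$ satisfying: constant rule $u\mathsf{b}=0$; product rule $\nabla\mathsf{b}=\big((1\otimes\mathsf{b})+(\mathsf{b}\otimes1)(1\otimes\sigma)\big)(\nabla\otimes1)$; linear rule $\alpha\mathsf{b}=u\otimes1$; chain rule $\nu\mathsf{b}=\mathsf{b}(\nu\otimes\mathsf{b})(\nabla\otimes1):TTM\to TM\otimes M$ (first $\mathsf{b}$ on the right at $TM$); interchange rule $\mathsf{b}(\mathsf{b}\otimes1)=\mathsf{b}(\mathsf{b}\otimes1)(1\otimes\sigma)$.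 The modality $\mathsf{Diff}$. For an $R$-module $M$, $\mathsf{Diff}(M)=\mathsf{Sym}(\bigoplus_{n=0}^\infty M)$, with $\mathsf{Sym}$ the free symmetric (commutative) algebra, and $\nabla,u$ its multiplication and unit. Let $\iota_k:M\to\bigoplus_{n\ge0}M$ be the injections, and $\eta,\mu$ the unit and multiplication of the monad $\mathsf{Sym}$. Let $\mathsf{D}:\mathsf{Diff}(M)\to\mathsf{Diff}(M)$ be the $R$-linear derivation determined on generators by $\mathsf{D}(\iota_k(m))=\iota_{k+1}(m)$; then $(\mathsf{Diff}(M),\mathsf{D})$ is the free commutative differential algebra on $M$ (a differential algebra being a commutative $R$-algebra with an $R$-linear derivation). The monad unit is $\alpha=\iota_0\eta:M\to\mathsf{Diff}(M)$. The monad multiplication is $\nu=\mathsf{Sym}(\psi)\mu:\mathsf{Diff}(\mathsf{Diff}(M))\to\mathsf{Diff}(M)$, where $\psi:\bigoplus_{n\ge0}\mathsf{Diff}(M)\to\mathsf{Diff}(M)$ is determined by $\iota_k\psi=\mathsf{D}^k$ for all $k\ge 0$. *)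

theory Defs
  imports "HOL-Algebra.Module"
begin

notation fcomp (infixl "\<circ>>" 60)

section \<open>A small category of modules\<close>

text \<open>
  HOL has no type of all \<open>R\<close>-modules, so \<open>MOD\<^sub>R\<close> is taken to consist of the \<open>R\<close>-modules whose
  carrier is a set of elements of one fixed type, which is chosen to be closed under the
  constructions needed: \<open>Family\<close> hosts the elements of \<open>\<Oplus>\<^sub>n M\<close>, and formal expressions
  in generators host the elements of symmetric algebras and (with generators
  \<open>Duo m n\<close>) of tensor products. Through \<open>Atom\<close> the type contains a copy of the arbitrary
  type \<open>'a\<close>, so that every module, on whatever type, is isomorphic to an object of \<open>MOD\<^sub>R\<close> for a
  suitable \<open>'a\<close>.
\<close>

datatype ('r, 'a) elem =
    Atom 'a
  | Family (component: "nat \<Rightarrow> ('r, 'a) elem")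
  | Duo (left: "('r, 'a) elem") (right: "('r, 'a) elem")
  | Gen "('r, 'a) elem"
  | Zero
  | One
  | Plus "('r, 'a) elem" "('r, 'a) elem"
  | Times "('r, 'a) elem" "('r, 'a) elem"
  | Smult 'r "('r, 'a) elem"

text \<open>
  The library's type of modules extends that of rings; the multiplication and unit fields of an
  object are meaningful only for those objects that are considered as algebras.
\<close>

type_synonym ('r, 'a) obj = "('r, ('r, 'a) elem) module"
type_synonym ('r, 'a) fn = "('r, 'a) elem \<Rightarrow> ('r, 'a) elem"

definition lin_hom ::
  "('r, 'c) ring_scheme \<Rightarrow> ('r, 'b, 'd) module_scheme \<Rightarrow> ('r, 'e, 'f) module_scheme \<Rightarrow> ('b \<Rightarrow> 'e) set"
  where "lin_hom R M N = {f \<in> carrier M \<rightarrow> carrier N.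
    (\<forall>x\<in>carrier M. \<forall>y\<in>carrier M. f (x \<oplus>\<^bsub>M\<^esub> y) = f x \<oplus>\<^bsub>N\<^esub> f y) \<and>
    (\<forall>r\<in>carrier R. \<forall>x\<in>carrier M. f (r \<odot>\<^bsub>M\<^esub> x) = r \<odot>\<^bsub>N\<^esub> f x)}"

section \<open>Modules and algebras given by generators and relations\<close>

text \<open>
  The smallest congruence on the set of expressions \<open>T\<close> that contains \<open>E\<close> and the
  laws of an \<open>R\<close>-module and, if \<open>T\<close> contains products, of a commutative \<open>R\<close>-algebra.
\<close>

inductive pres_eq ::
  "('r, 'c) ring_scheme \<Rightarrow> ('r, 'a) elem set \<Rightarrow> (('r, 'a) elem \<Rightarrow> ('r, 'a) elem \<Rightarrow> bool) \<Rightarrow>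
   ('r, 'a) elem \<Rightarrow> ('r, 'a) elem \<Rightarrow> bool"
  for R :: "('r, 'c) ring_scheme" and T E
  where
  rel: "E s t \<Longrightarrow> pres_eq R T E s t"
| refl: "s \<in> T \<Longrightarrow> pres_eq R T E s s"
| sym: "pres_eq R T E s t \<Longrightarrow> pres_eq R T E t s"
| trans: "pres_eq R T E s t \<Longrightarrow> pres_eq R T E t u \<Longrightarrow> pres_eq R T E s u"
| plus_cong: "pres_eq R T E s s' \<Longrightarrow> pres_eq R T E t t' \<Longrightarrow> pres_eq R T E (Plus s t) (Plus s' t')"
| smult_cong: "r \<in> carrier R \<Longrightarrow> pres_eq R T E s s' \<Longrightarrow> pres_eq R T E (Smult r s) (Smult r s')"
| times_cong: "Times s t \<in> T \<Longrightarrow> pres_eq R T E s s' \<Longrightarrow> pres_eq R T E t t' \<Longrightarrow>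
    pres_eq R T E (Times s t) (Times s' t')"
| plus_assoc: "s \<in> T \<Longrightarrow> t \<in> T \<Longrightarrow> u \<in> T \<Longrightarrow>
    pres_eq R T E (Plus (Plus s t) u) (Plus s (Plus t u))"
| plus_comm: "s \<in> T \<Longrightarrow> t \<in> T \<Longrightarrow> pres_eq R T E (Plus s t) (Plus t s)"
| plus_zero: "s \<in> T \<Longrightarrow> pres_eq R T E (Plus Zero s) s"
| plus_neg: "s \<in> T \<Longrightarrow> pres_eq R T E (Plus (Smult (\<ominus>\<^bsub>R\<^esub> \<one>\<^bsub>R\<^esub>) s) s) Zero"
| smult_add: "r \<in> carrier R \<Longrightarrow> q \<in> carrier R \<Longrightarrow> s \<in> T \<Longrightarrow>
    pres_eq R T E (Smult (r \<oplus>\<^bsub>R\<^esub> q) s) (Plus (Smult r s) (Smult q s))"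
| smult_plus: "r \<in> carrier R \<Longrightarrow> s \<in> T \<Longrightarrow> t \<in> T \<Longrightarrow>
    pres_eq R T E (Smult r (Plus s t)) (Plus (Smult r s) (Smult r t))"
| smult_mult: "r \<in> carrier R \<Longrightarrow> q \<in> carrier R \<Longrightarrow> s \<in> T \<Longrightarrow>
    pres_eq R T E (Smult (r \<otimes>\<^bsub>R\<^esub> q) s) (Smult r (Smult q s))"
| smult_one: "s \<in> T \<Longrightarrow> pres_eq R T E (Smult \<one>\<^bsub>R\<^esub> s) s"
| times_assoc: "Times (Times s t) u \<in> T \<Longrightarrow>
    pres_eq R T E (Times (Times s t) u) (Times s (Times t u))"
| times_comm: "Times s t \<in> T \<Longrightarrow> pres_eq R T E (Times s t) (Times t s)"
| times_one: "Times One s \<in> T \<Longrightarrow> pres_eq R T E (Times One s) s"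
| times_plus: "Times (Plus s t) u \<in> T \<Longrightarrow>
    pres_eq R T E (Times (Plus s t) u) (Plus (Times s u) (Times t u))"
| times_smult: "Times (Smult r s) t \<in> T \<Longrightarrow>
    pres_eq R T E (Times (Smult r s) t) (Smult r (Times s t))"

text \<open>
  The elements of the quotient are chosen representatives, since the congruence classes themselves
  would not live in the type \<open>elem\<close>.
\<close>

definition repr ::
  "('r, 'c) ring_scheme \<Rightarrow> ('r, 'a) elem set \<Rightarrow> (('r, 'a) elem \<Rightarrow> ('r, 'a) elem \<Rightarrow> bool) \<Rightarrow> ('r, 'a) fn"
  where "repr R T E t = (SOME s. pres_eq R T E t s)"

definition presented ::
  "('r, 'c) ring_scheme \<Rightarrow> ('r, 'a) elem set \<Rightarrow> (('r, 'a) elem \<Rightarrow> ('r, 'a) elem \<Rightarrow> bool) \<Rightarrow> ('r, 'a) obj"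
  where "presented R T E =
    \<lparr>carrier = repr R T E ` T,
     mult = (\<lambda>s t. repr R T E (Times s t)), one = repr R T E One,
     zero = repr R T E Zero, add = (\<lambda>s t. repr R T E (Plus s t)),
     smult = (\<lambda>r s. repr R T E (Smult r s))\<rparr>"

text \<open>The value in \<open>A\<close> of an expression, given values for the generators.\<close>

primrec (nonexhaustive) evaluate ::
  "('r, 'b, 'd) module_scheme \<Rightarrow> (('r, 'a) elem \<Rightarrow> 'b) \<Rightarrow> ('r, 'a) elem \<Rightarrow> 'b"
  where
  "evaluate A f (Gen x) = f x"
| "evaluate A f Zero = \<zero>\<^bsub>A\<^esub>"
| "evaluate A f One = \<one>\<^bsub>A\<^esub>"
| "evaluate A f (Plus s t) = evaluate A f s \<oplus>\<^bsub>A\<^esub> evaluate A f t"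
| "evaluate A f (Times s t) = evaluate A f s \<otimes>\<^bsub>A\<^esub> evaluate A f t"
| "evaluate A f (Smult r s) = r \<odot>\<^bsub>A\<^esub> evaluate A f s"

section \<open>The tensor product\<close>

inductive_set tensor_terms ::
  "('r, 'c) ring_scheme \<Rightarrow> ('r, 'a) obj \<Rightarrow> ('r, 'a) obj \<Rightarrow> ('r, 'a) elem set"
  for R :: "('r, 'c) ring_scheme" and M N
  where
  "m \<in> carrier M \<Longrightarrow> n \<in> carrier N \<Longrightarrow> Gen (Duo m n) \<in> tensor_terms R M N"
| "Zero \<in> tensor_terms R M N"
| "s \<in> tensor_terms R M N \<Longrightarrow> t \<in> tensor_terms R M N \<Longrightarrow> Plus s t \<in> tensor_terms R M N"
| "r \<in> carrier R \<Longrightarrow> s \<in> tensor_terms R M N \<Longrightarrow> Smult r s \<in> tensor_terms R M N"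

inductive tensor_rel ::
  "('r, 'c) ring_scheme \<Rightarrow> ('r, 'a) obj \<Rightarrow> ('r, 'a) obj \<Rightarrow> ('r, 'a) elem \<Rightarrow> ('r, 'a) elem \<Rightarrow> bool"
  for R :: "('r, 'c) ring_scheme" and M N
  where
  "m \<in> carrier M \<Longrightarrow> m' \<in> carrier M \<Longrightarrow> n \<in> carrier N \<Longrightarrow>
    tensor_rel R M N (Gen (Duo (m \<oplus>\<^bsub>M\<^esub> m') n)) (Plus (Gen (Duo m n)) (Gen (Duo m' n)))"
| "m \<in> carrier M \<Longrightarrow> n \<in> carrier N \<Longrightarrow> n' \<in> carrier N \<Longrightarrow>
    tensor_rel R M N (Gen (Duo m (n \<oplus>\<^bsub>N\<^esub> n'))) (Plus (Gen (Duo m n)) (Gen (Duo m n')))"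
| "r \<in> carrier R \<Longrightarrow> m \<in> carrier M \<Longrightarrow> n \<in> carrier N \<Longrightarrow>
    tensor_rel R M N (Gen (Duo (r \<odot>\<^bsub>M\<^esub> m) n)) (Smult r (Gen (Duo m n)))"
| "r \<in> carrier R \<Longrightarrow> m \<in> carrier M \<Longrightarrow> n \<in> carrier N \<Longrightarrow>
    tensor_rel R M N (Gen (Duo m (r \<odot>\<^bsub>N\<^esub> n))) (Smult r (Gen (Duo m n)))"

definition tensor :: "('r, 'c) ring_scheme \<Rightarrow> ('r, 'a) obj \<Rightarrow> ('r, 'a) obj \<Rightarrow> ('r, 'a) obj"
  where "tensor R M N = presented R (tensor_terms R M N) (tensor_rel R M N)"

definition pure ::
  "('r, 'c) ring_scheme \<Rightarrow> ('r, 'a) obj \<Rightarrow> ('r, 'a) obj \<Rightarrow>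
   ('r, 'a) elem \<Rightarrow> ('r, 'a) elem \<Rightarrow> ('r, 'a) elem"
  where "pure R M N m n = repr R (tensor_terms R M N) (tensor_rel R M N) (Gen (Duo m n))"

text \<open>For bilinear \<open>f\<close>, the linear map into \<open>P\<close> with \<open>m \<otimes> n \<mapsto> f m n\<close>.\<close>

definition tensor_lift ::
  "('r, 'b, 'd) module_scheme \<Rightarrow> (('r, 'a) elem \<Rightarrow> ('r, 'a) elem \<Rightarrow> 'b) \<Rightarrow> ('r, 'a) elem \<Rightarrow> 'b"
  where "tensor_lift P f = evaluate P (\<lambda>x. f (left x) (right x))"

text \<open>The map \<open>f \<otimes> g\<close> with codomain \<open>M \<otimes> N\<close>.\<close>

definition tensor_map ::
  "('r, 'c) ring_scheme \<Rightarrow> ('r, 'a) obj \<Rightarrow> ('r, 'a) obj \<Rightarrow> ('r, 'a) fn \<Rightarrow> ('r, 'a) fn \<Rightarrow> ('r, 'a) fn"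
  where "tensor_map R M N f g = tensor_lift (tensor R M N) (\<lambda>m n. pure R M N (f m) (g n))"

definition braid :: "('r, 'c) ring_scheme \<Rightarrow> ('r, 'a) obj \<Rightarrow> ('r, 'a) obj \<Rightarrow> ('r, 'a) fn"
  where "braid R M N = tensor_lift (tensor R N M) (\<lambda>m n. pure R N M n m)"

definition assoc_right ::
  "('r, 'c) ring_scheme \<Rightarrow> ('r, 'a) obj \<Rightarrow> ('r, 'a) obj \<Rightarrow> ('r, 'a) obj \<Rightarrow> ('r, 'a) fn"
  where "assoc_right R L M N =
    (let P = tensor R L (tensor R M N) in
     tensor_lift P (\<lambda>x n. tensor_lift P (\<lambda>l m. pure R L (tensor R M N) l (pure R M N m n)) x))"

definition assoc_left ::
  "('r, 'c) ring_scheme \<Rightarrow> ('r, 'a) obj \<Rightarrow> ('r, 'a) obj \<Rightarrow> ('r, 'a) obj \<Rightarrow> ('r, 'a) fn"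
  where "assoc_left R L M N =
    (let P = tensor R (tensor R L M) N in
     tensor_lift P (\<lambda>l x. tensor_lift P (\<lambda>m n. pure R (tensor R L M) N (pure R L M l m) n) x))"

section \<open>Deriving transformations\<close>

text \<open>
  The structure maps of an algebra modality. \<open>T_map M N f\<close> is the functor applied to \<open>f : M \<rightarrow> N\<close>;
  \<open>T_nabla M\<close> is defined on \<open>TM \<otimes> TM\<close> and \<open>T_unit M\<close> on \<open>R\<close>.
\<close>

record ('r, 'a) modality =
  T_obj :: "('r, 'a) obj \<Rightarrow> ('r, 'a) obj"
  T_map :: "('r, 'a) obj \<Rightarrow> ('r, 'a) obj \<Rightarrow> ('r, 'a) fn \<Rightarrow> ('r, 'a) fn"
  T_nu :: "('r, 'a) obj \<Rightarrow> ('r, 'a) fn"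
  T_alpha :: "('r, 'a) obj \<Rightarrow> ('r, 'a) fn"
  T_nabla :: "('r, 'a) obj \<Rightarrow> ('r, 'a) fn"
  T_unit :: "('r, 'a) obj \<Rightarrow> 'r \<Rightarrow> ('r, 'a) elem"

text \<open>
  The usually suppressed associators are written out. In the linear rule, the unitor
  \<open>M \<cong> R \<otimes> M\<close> followed by \<open>u \<otimes> 1\<close> is \<open>m \<mapsto> u(1) \<otimes> m\<close>. The interchange rule is stated after
  reassociating its codomain to \<open>TM \<otimes> (M \<otimes> M)\<close>.
\<close>

locale deriving_transformation =
  fixes R :: "('r, 'c) ring_scheme"
    and T :: "('r, 'a) modality"
    and b :: "('r, 'a) obj \<Rightarrow> ('r, 'a) fn"
  assumes linear: "module R M \<Longrightarrow>
      b M \<in> lin_hom R (T_obj T M) (tensor R (T_obj T M) M)"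
    and natural: "module R M \<Longrightarrow> module R N \<Longrightarrow> f \<in> lin_hom R M N \<Longrightarrow> x \<in> carrier (T_obj T M) \<Longrightarrow>
      (T_map T M N f \<circ>> b N) x = (b M \<circ>> tensor_map R (T_obj T N) N (T_map T M N f) f) x"
    and constant_rule: "module R M \<Longrightarrow> r \<in> carrier R \<Longrightarrow>
      (T_unit T M \<circ>> b M) r = \<zero>\<^bsub>tensor R (T_obj T M) M\<^esub>"
    and product_rule: "module R M \<Longrightarrow> A = T_obj T M \<Longrightarrow> x \<in> carrier (tensor R A A) \<Longrightarrow>
      (T_nabla T M \<circ>> b M) x =
      (assoc_left R A A M \<circ>> tensor_map R A M (T_nabla T M) id)
        (tensor_map R A (tensor R A M) id (b M) x
          \<oplus>\<^bsub>tensor R A (tensor R A M)\<^esub>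
         (tensor_map R (tensor R A M) A (b M) id \<circ>> assoc_right R A M A
           \<circ>> tensor_map R A (tensor R A M) id (braid R M A)) x)"
    and linear_rule: "module R M \<Longrightarrow> m \<in> carrier M \<Longrightarrow>
      (T_alpha T M \<circ>> b M) m = pure R (T_obj T M) M (T_unit T M \<one>\<^bsub>R\<^esub>) m"
    and chain_rule: "module R M \<Longrightarrow> A = T_obj T M \<Longrightarrow> x \<in> carrier (T_obj T A) \<Longrightarrow>
      (T_nu T M \<circ>> b M) x =
      (b A \<circ>> tensor_map R A (tensor R A M) (T_nu T M) (b M)
        \<circ>> assoc_left R A A M \<circ>> tensor_map R A M (T_nabla T M) id) x"
    and interchange_rule: "module R M \<Longrightarrow> A = T_obj T M \<Longrightarrow> x \<in> carrier A \<Longrightarrow>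
      (b M \<circ>> tensor_map R (tensor R A M) M (b M) id \<circ>> assoc_right R A M M) x =
      (b M \<circ>> tensor_map R (tensor R A M) M (b M) id \<circ>> assoc_right R A M M
        \<circ>> tensor_map R A (tensor R M M) id (braid R M M)) x"

section \<open>The symmetric algebra\<close>

inductive_set sym_terms :: "('r, 'c) ring_scheme \<Rightarrow> ('r, 'a) obj \<Rightarrow> ('r, 'a) elem set"
  for R :: "('r, 'c) ring_scheme" and N
  where
  "n \<in> carrier N \<Longrightarrow> Gen n \<in> sym_terms R N"
| "Zero \<in> sym_terms R N"
| "One \<in> sym_terms R N"
| "s \<in> sym_terms R N \<Longrightarrow> t \<in> sym_terms R N \<Longrightarrow> Plus s t \<in> sym_terms R N"
| "s \<in> sym_terms R N \<Longrightarrow> t \<in> sym_terms R N \<Longrightarrow> Times s t \<in> sym_terms R N"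
| "r \<in> carrier R \<Longrightarrow> s \<in> sym_terms R N \<Longrightarrow> Smult r s \<in> sym_terms R N"

inductive sym_rel ::
  "('r, 'c) ring_scheme \<Rightarrow> ('r, 'a) obj \<Rightarrow> ('r, 'a) elem \<Rightarrow> ('r, 'a) elem \<Rightarrow> bool"
  for R :: "('r, 'c) ring_scheme" and N
  where
  "n \<in> carrier N \<Longrightarrow> n' \<in> carrier N \<Longrightarrow> sym_rel R N (Gen (n \<oplus>\<^bsub>N\<^esub> n')) (Plus (Gen n) (Gen n'))"
| "r \<in> carrier R \<Longrightarrow> n \<in> carrier N \<Longrightarrow> sym_rel R N (Gen (r \<odot>\<^bsub>N\<^esub> n)) (Smult r (Gen n))"

definition Sym :: "('r, 'c) ring_scheme \<Rightarrow> ('r, 'a) obj \<Rightarrow> ('r, 'a) obj"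
  where "Sym R N = presented R (sym_terms R N) (sym_rel R N)"

definition sym_repr :: "('r, 'c) ring_scheme \<Rightarrow> ('r, 'a) obj \<Rightarrow> ('r, 'a) fn"
  where "sym_repr R N = repr R (sym_terms R N) (sym_rel R N)"

definition sym_eta :: "('r, 'c) ring_scheme \<Rightarrow> ('r, 'a) obj \<Rightarrow> ('r, 'a) fn"
  where "sym_eta R N n = sym_repr R N (Gen n)"

text \<open>The functor \<open>Sym\<close> applied to a map with codomain \<open>N\<close>.\<close>

definition sym_map :: "('r, 'c) ring_scheme \<Rightarrow> ('r, 'a) obj \<Rightarrow> ('r, 'a) fn \<Rightarrow> ('r, 'a) fn"
  where "sym_map R N f = evaluate (Sym R N) (f \<circ>> sym_eta R N)"

definition sym_mu :: "('r, 'c) ring_scheme \<Rightarrow> ('r, 'a) obj \<Rightarrow> ('r, 'a) fn"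
  where "sym_mu R N = evaluate (Sym R N) id"

text \<open>For linear \<open>d\<close>, the derivation of \<open>Sym R N\<close> with \<open>sym_eta R N n \<mapsto> d n\<close>.\<close>

primrec (nonexhaustive) sym_derivation ::
  "('r, 'c) ring_scheme \<Rightarrow> ('r, 'a) obj \<Rightarrow> ('r, 'a) fn \<Rightarrow> ('r, 'a) fn"
  where
  "sym_derivation R N d (Gen n) = d n"
| "sym_derivation R N d Zero = \<zero>\<^bsub>Sym R N\<^esub>"
| "sym_derivation R N d One = \<zero>\<^bsub>Sym R N\<^esub>"
| "sym_derivation R N d (Plus s t) =
    sym_derivation R N d s \<oplus>\<^bsub>Sym R N\<^esub> sym_derivation R N d t"
| "sym_derivation R N d (Times s t) =
    (sym_derivation R N d s \<otimes>\<^bsub>Sym R N\<^esub> sym_repr R N t)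
      \<oplus>\<^bsub>Sym R N\<^esub> (sym_repr R N s \<otimes>\<^bsub>Sym R N\<^esub> sym_derivation R N d t)"
| "sym_derivation R N d (Smult r s) = r \<odot>\<^bsub>Sym R N\<^esub> sym_derivation R N d s"

section \<open>The direct sum of countably many copies\<close>

definition dsum :: "('r, 'a) obj \<Rightarrow> ('r, 'a) obj"
  where "dsum M =
    \<lparr>carrier = {Family f |f. (\<forall>n. f n \<in> carrier M) \<and> finite {n. f n \<noteq> \<zero>\<^bsub>M\<^esub>}},
     mult = undefined, one = undefined,
     zero = Family (\<lambda>n. \<zero>\<^bsub>M\<^esub>),
     add = (\<lambda>x y. Family (\<lambda>n. component x n \<oplus>\<^bsub>M\<^esub> component y n)),
     smult = (\<lambda>r x. Family (\<lambda>n. r \<odot>\<^bsub>M\<^esub> component x n))\<rparr>"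

definition dsum_in :: "('r, 'a) obj \<Rightarrow> nat \<Rightarrow> ('r, 'a) fn"
  where "dsum_in M k m = Family (\<lambda>n. if n = k then m else \<zero>\<^bsub>M\<^esub>)"

text \<open>The map \<open>h\<close> from \<open>dsum M\<close> to \<open>P\<close> determined by \<open>\<iota>\<^sub>k h = g k\<close>.\<close>

definition dsum_copair ::
  "('r, 'a) obj \<Rightarrow> ('r, 'a) obj \<Rightarrow> (nat \<Rightarrow> ('r, 'a) fn) \<Rightarrow> ('r, 'a) fn"
  where "dsum_copair M P g x =
    (\<Oplus>\<^bsub>P\<^esub>n\<in>{n. component x n \<noteq> \<zero>\<^bsub>M\<^esub>}. g n (component x n))"

definition dsum_map :: "('r, 'a) fn \<Rightarrow> ('r, 'a) fn"
  where "dsum_map f x = Family (\<lambda>n. f (component x n))"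

section \<open>The free differential algebra modality\<close>

definition Diff_obj :: "('r, 'c) ring_scheme \<Rightarrow> ('r, 'a) obj \<Rightarrow> ('r, 'a) obj"
  where "Diff_obj R M = Sym R (dsum M)"

definition Diff_D :: "('r, 'c) ring_scheme \<Rightarrow> ('r, 'a) obj \<Rightarrow> ('r, 'a) fn"
  where "Diff_D R M = sym_derivation R (dsum M)
    (dsum_copair M (dsum M) (\<lambda>k. dsum_in M (Suc k)) \<circ>> sym_eta R (dsum M))"

definition Diff_psi :: "('r, 'c) ring_scheme \<Rightarrow> ('r, 'a) obj \<Rightarrow> ('r, 'a) fn"
  where "Diff_psi R M = dsum_copair (Diff_obj R M) (Diff_obj R M) (\<lambda>k. Diff_D R M ^^ k)"

definition Diff :: "('r, 'c) ring_scheme \<Rightarrow> ('r, 'a) modality"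
  where "Diff R =
    \<lparr>T_obj = Diff_obj R,
     T_map = (\<lambda>M N f. sym_map R (dsum N) (dsum_map f)),
     T_nu = (\<lambda>M. sym_map R (Diff_obj R M) (Diff_psi R M) \<circ>> sym_mu R (dsum M)),
     T_alpha = (\<lambda>M. dsum_in M 0 \<circ>> sym_eta R (dsum M)),
     T_nabla = (\<lambda>M. tensor_lift (Diff_obj R M) (mult (Diff_obj R M))),
     T_unit = (\<lambda>M r. r \<odot>\<^bsub>Diff_obj R M\<^esub> \<one>\<^bsub>Diff_obj R M\<^esub>)\<rparr>"

end

(*
  With x, y the generators of order 0 of Diff(R^2) and x', y' their derivatives, the chain rule at
  D(xy), viewed as the element of order 1 with value xy of Diff(Diff(R^2)), expresses b(D(xy)) as a
  multiple of b(xy) = x (1 (x) e2) + y (1 (x) e1), so it vanishes at every point where x = y = 0. The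
  product rule instead applies to D(xy) = x'y + xy', and its coefficient at e1, evaluated where
  x = y = 0, is y'. Since y' can be given the value 1, this forces 1 = 0 in R. Two variables are
  used because b(D(x^2)) would only give 2x' = 0,
  which is vacuous in characteristic 2.
*)

theory Submission
  imports Defs
begin

section \<open>Linear and bilinear maps\<close>

text \<open>The multiple that the chain rule produces is not known: naturality shows only that
  \<open>b\<close>, at the order-1 generator with value w = xy, comes from Diff(N) \<otimes> N for a
  module N with a linear form c and an element e such that c(e) = 1, where e is sent to w. Nothing
  is learned about the first tensor factors. They become harmless at a point where b(w) vanishes,
  which is why a point is needed at all. Freeness of Diff makes the values of y and y' at a point
  independent, so that y = 0 and y' = 1 are compatible. No basis of Diff(M) \<otimes> M is computed.
  The coefficient at the first basis vector is read off by a functional built from a point of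
  Diff(M) and a linear form on M; composed with it, each rule for \<open>b\<close> becomes an
  identity of scalars. The cost is to establish the universal properties of tensor products,
  symmetric algebras and direct sums for the given models made of expressions.\<close>

lemma lin_homI:
  assumes "\<And>x. x \<in> carrier M \<Longrightarrow> f x \<in> carrier N"
    and "\<And>x y. x \<in> carrier M \<Longrightarrow> y \<in> carrier M \<Longrightarrow> f (x \<oplus>\<^bsub>M\<^esub> y) = f x \<oplus>\<^bsub>N\<^esub> f y"
    and "\<And>r x. r \<in> carrier R \<Longrightarrow> x \<in> carrier M \<Longrightarrow> f (r \<odot>\<^bsub>M\<^esub> x) = r \<odot>\<^bsub>N\<^esub> f x"
  shows "f \<in> lin_hom R M N"
  using assms by (auto simp: lin_hom_def)

lemma lin_homD:
  assumes "f \<in> lin_hom R M N" and "x \<in> carrier M"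
  shows lin_hom_closed: "f x \<in> carrier N"
    and lin_hom_add: "y \<in> carrier M \<Longrightarrow> f (x \<oplus>\<^bsub>M\<^esub> y) = f x \<oplus>\<^bsub>N\<^esub> f y"
    and lin_hom_smult: "r \<in> carrier R \<Longrightarrow> f (r \<odot>\<^bsub>M\<^esub> x) = r \<odot>\<^bsub>N\<^esub> f x"
  using assms by (auto simp: lin_hom_def)

lemma lin_hom_zero:
  assumes "module R M" "module R N" "f \<in> lin_hom R M N"
  shows "f \<zero>\<^bsub>M\<^esub> = \<zero>\<^bsub>N\<^esub>"
proof -
  interpret M: module R M by fact
  interpret N: module R N by fact
  have "f (\<zero>\<^bsub>R\<^esub> \<odot>\<^bsub>M\<^esub> \<zero>\<^bsub>M\<^esub>) = \<zero>\<^bsub>R\<^esub> \<odot>\<^bsub>N\<^esub> f \<zero>\<^bsub>M\<^esub>"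
    using assms(3) by (rule lin_hom_smult) simp_all
  then show ?thesis
    using lin_hom_closed[OF assms(3)] by simp
qed

lemma lin_hom_compose:
  assumes "f \<in> lin_hom R M N" "g \<in> lin_hom R N P"
  shows "(\<lambda>x. g (f x)) \<in> lin_hom R M P"
  using assms by (auto simp: lin_hom_def Pi_iff)

lemma lin_hom_fcomp: "f \<in> lin_hom R M N \<Longrightarrow> g \<in> lin_hom R N P \<Longrightarrow> f \<circ>> g \<in> lin_hom R M P"
  unfolding fcomp_def comp_def by (rule lin_hom_compose)

lemma lin_hom_id: "id \<in> lin_hom R M M"
  by (auto simp: lin_hom_def)

lemma lin_hom_sum:
  assumes "module R P" and f: "f \<in> lin_hom R M P" and g: "g \<in> lin_hom R M P"
  shows "(\<lambda>x. f x \<oplus>\<^bsub>P\<^esub> g x) \<in> lin_hom R M P"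
proof -
  interpret P: module R P by fact
  note c = lin_hom_closed[OF f] lin_hom_closed[OF g]
  show ?thesis
    by (rule lin_homI)
      (simp_all add: c lin_hom_add[OF f] lin_hom_add[OF g] lin_hom_smult[OF f] lin_hom_smult[OF g]
        P.smult_r_distr P.a_ac)
qed

lemma lin_hom_scale:
  assumes "module R P" and f: "f \<in> lin_hom R M P" and "r \<in> carrier R"
  shows "(\<lambda>x. r \<odot>\<^bsub>P\<^esub> f x) \<in> lin_hom R M P"
proof -
  interpret P: module R P by fact
  show ?thesis
    using assms(3) by (intro lin_homI)
      (simp_all add: lin_hom_closed[OF f] lin_hom_add[OF f] lin_hom_smult[OF f]
        P.smult_r_distr flip: P.smult_assoc1, simp add: P.R.m_comm)
qed

lemma lin_hom_null:
  assumes "module R P"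
  shows "(\<lambda>x. \<zero>\<^bsub>P\<^esub>) \<in> lin_hom R M P"
proof -
  interpret P: module R P by fact
  show ?thesis
    by (intro lin_homI) simp_all
qed

text \<open>Stated through slices so that every fact about \<open>lin_hom\<close> applies directly
  in either variable.\<close>

definition bilin_map ::
  "('r, 'c) ring_scheme \<Rightarrow> ('r, 'b, 'd) module_scheme \<Rightarrow> ('r, 'e, 'f) module_scheme \<Rightarrow>
   ('r, 'g, 'h) module_scheme \<Rightarrow> ('b \<Rightarrow> 'e \<Rightarrow> 'g) set"
  where "bilin_map R M N P = {f. (\<forall>m\<in>carrier M. f m \<in> lin_hom R N P) \<and>
    (\<forall>n\<in>carrier N. (\<lambda>m. f m n) \<in> lin_hom R M P)}"

lemma bilin_mapI:
  assumes "\<And>m. m \<in> carrier M \<Longrightarrow> f m \<in> lin_hom R N P"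
    and "\<And>n. n \<in> carrier N \<Longrightarrow> (\<lambda>m. f m n) \<in> lin_hom R M P"
  shows "f \<in> bilin_map R M N P"
  using assms by (simp add: bilin_map_def)

lemma bilin_mapD:
  assumes "f \<in> bilin_map R M N P"
  shows bilin_map_right: "m \<in> carrier M \<Longrightarrow> f m \<in> lin_hom R N P"
    and bilin_map_left: "n \<in> carrier N \<Longrightarrow> (\<lambda>m. f m n) \<in> lin_hom R M P"
  using assms by (simp_all add: bilin_map_def)

lemma bilin_map_compose:
  assumes "h \<in> bilin_map R M' N' P" "f \<in> lin_hom R M M'" "g \<in> lin_hom R N N'"
  shows "(\<lambda>m n. h (f m) (g n)) \<in> bilin_map R M N P"
  using assms
  by (intro bilin_mapI)
    (blast intro: lin_hom_compose lin_hom_closed bilin_map_right bilin_map_left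
      lin_hom_compose[where f = f and g = "\<lambda>m. h m c" for c])+

lemma bilin_map_swap: "f \<in> bilin_map R M N P \<Longrightarrow> (\<lambda>n m. f m n) \<in> bilin_map R N M P"
  by (simp add: bilin_map_def)

text \<open>Its elements have type \<open>'r\<close> and not \<open>elem\<close>, so it is not an
  object of the module category. It serves as codomain for evaluations and functionals, which may
  take values in a module on any type.\<close>

definition self_algebra :: "('r, 'c) ring_scheme \<Rightarrow> ('r, 'r) module"
  where "self_algebra R =
    \<lparr>carrier = carrier R, mult = mult R, one = \<one>\<^bsub>R\<^esub>, zero = \<zero>\<^bsub>R\<^esub>, add = add R, smult = mult R\<rparr>"

lemma self_algebra_simps [simp]:
  "carrier (self_algebra R) = carrier R"
  "mult (self_algebra R) = mult R"
  "one (self_algebra R) = one R"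
  "zero (self_algebra R) = zero R"
  "add (self_algebra R) = add R"
  "smult (self_algebra R) = mult R"
  by (simp_all add: self_algebra_def)

lemma algebra_self:
  assumes "cring R"
  shows "algebra R (self_algebra R)"
proof -
  interpret R: cring R by fact
  have "cring (self_algebra R)"
    by (intro cringI abelian_groupI comm_monoidI)
      (auto simp: R.a_ac R.m_assoc R.l_distr intro: R.m_comm R.a_inv_closed R.l_neg)
  then show ?thesis
    using assms by (intro algebraI) (auto simp: R.l_distr R.r_distr R.m_ac)
qed

lemma module_self: "cring R \<Longrightarrow> module R (self_algebra R)"
  by (rule algebra.module[OF algebra_self])

section \<open>Presented modules and algebras\<close>

text \<open>Whether \<^term>\<open>One\<close> belongs to \<^term>\<open>T\<close> tells a presentation of an algebra from one of a
  module.\<close>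

locale presentation = cring R
  for R :: "('r, 'c) ring_scheme" (structure) and T :: "('r, 'a) elem set"
    and E :: "('r, 'a) elem \<Rightarrow> ('r, 'a) elem \<Rightarrow> bool" +
  assumes rel_mem: "E s t \<Longrightarrow> s \<in> T \<and> t \<in> T"
    and zero_mem [simp]: "Zero \<in> T"
    and plus_mem [simp]: "Plus s t \<in> T \<longleftrightarrow> s \<in> T \<and> t \<in> T"
    and smult_mem [simp]: "Smult r s \<in> T \<longleftrightarrow> r \<in> carrier R \<and> s \<in> T"
    and times_mem [simp]: "Times s t \<in> T \<longleftrightarrow> One \<in> T \<and> s \<in> T \<and> t \<in> T"
    and no_junk [simp]: "Atom a \<notin> T" "Family g \<notin> T" "Duo s t \<notin> T"
begin

lemma eq_mem: "pres_eq R T E s t \<Longrightarrow> s \<in> T \<and> t \<in> T"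
  by (induction rule: pres_eq.induct) (auto dest: rel_mem)

lemma eq_repr: "t \<in> T \<Longrightarrow> pres_eq R T E t (repr R T E t)"
  unfolding repr_def by (rule someI[of _ t]) (rule pres_eq.refl)

text \<open>Symmetry and transitivity make the two choice predicates equal, so \<open>Eps\<close>
  selects the same expression for both.\<close>

lemma repr_cong: "pres_eq R T E s t \<Longrightarrow> repr R T E s = repr R T E t"
  unfolding repr_def by (rule arg_cong[of _ _ Eps]) (blast intro: pres_eq.sym pres_eq.trans)

abbreviation "Q \<equiv> presented R T E"

lemma repr_carrier [simp]: "t \<in> T \<Longrightarrow> repr R T E t \<in> carrier Q"
  by (simp add: presented_def)

lemma carrier_cases:
  assumes "x \<in> carrier Q"
  obtains t where "t \<in> T" "x = repr R T E t"
  using assms by (auto simp: presented_def)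

text \<open>Addition in \<open>Q\<close> forms \<open>Plus\<close> of two representatives and
  normalises again; congruence absorbs the inner normalisation.\<close>

lemma repr_Plus: "s \<in> T \<Longrightarrow> t \<in> T \<Longrightarrow> repr R T E (Plus s t) = repr R T E s \<oplus>\<^bsub>Q\<^esub> repr R T E t"
  by (simp add: presented_def) (blast intro!: repr_cong pres_eq.plus_cong eq_repr)

lemma repr_Smult:
  "r \<in> carrier R \<Longrightarrow> s \<in> T \<Longrightarrow> repr R T E (Smult r s) = r \<odot>\<^bsub>Q\<^esub> repr R T E s"
  by (simp add: presented_def) (blast intro!: repr_cong pres_eq.smult_cong eq_repr)

lemma repr_Times:
  "One \<in> T \<Longrightarrow> s \<in> T \<Longrightarrow> t \<in> T \<Longrightarrow> repr R T E (Times s t) = repr R T E s \<otimes>\<^bsub>Q\<^esub> repr R T E t"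
  by (simp add: presented_def) (rule repr_cong, rule pres_eq.times_cong, auto intro: eq_repr)

lemma repr_Zero: "repr R T E Zero = \<zero>\<^bsub>Q\<^esub>"
  by (simp add: presented_def)

lemma repr_One: "repr R T E One = \<one>\<^bsub>Q\<^esub>"
  by (simp add: presented_def)

lemmas repr_simps = repr_Plus repr_Smult repr_Times repr_Zero repr_One

text \<open>Each law of the quotient is the clause of \<open>pres_eq\<close> that imposes it.
  Negatives are multiples by \<open>\<ominus> \<one>\<close>.\<close>

lemma presented_module: "module R Q"
proof (rule moduleI)
  show "cring R"
    by (rule is_cring)
  show "abelian_group Q"
  proof (rule abelian_groupI)
    fix x assume "x \<in> carrier Q"
    then obtain s where s: "s \<in> T" "x = repr R T E s"
      by (rule carrier_cases)
    have "repr R T E (Smult (\<ominus> \<one>) s) \<oplus>\<^bsub>Q\<^esub> x = \<zero>\<^bsub>Q\<^esub>"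
      using s repr_cong[OF pres_eq.plus_neg[OF s(1)]] by (simp add: repr_Plus repr_Zero)
    then show "\<exists>y\<in>carrier Q. y \<oplus>\<^bsub>Q\<^esub> x = \<zero>\<^bsub>Q\<^esub>"
      using s by (intro bexI[of _ "repr R T E (Smult (\<ominus> \<one>) s)"]) auto
  qed (auto elim!: carrier_cases simp flip: repr_Plus repr_Zero
      intro!: repr_cong pres_eq.plus_assoc pres_eq.plus_comm pres_eq.plus_zero)
qed (auto elim!: carrier_cases simp flip: repr_Plus repr_Smult
      intro!: repr_cong pres_eq.smult_add pres_eq.smult_plus pres_eq.smult_mult pres_eq.smult_one)

lemma presented_algebra:
  assumes "One \<in> T"
  shows "algebra R Q"
proof -
  interpret Q: module R Q
    by (rule presented_module)
  note [simp] = assms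
  have "comm_monoid Q"
    by (rule comm_monoidI)
      (auto elim!: carrier_cases simp flip: repr_Times repr_One
        intro!: repr_cong pres_eq.times_assoc pres_eq.times_comm pres_eq.times_one)
  then have "cring Q"
    by (intro cringI Q.abelian_group_axioms)
      (auto elim!: carrier_cases simp flip: repr_Times repr_Plus
        intro!: repr_cong pres_eq.times_plus)
  then show ?thesis
    by (intro algebraI is_cring Q.smult_closed Q.smult_l_distr Q.smult_r_distr Q.smult_assoc1
        Q.smult_one)
      (auto elim!: carrier_cases simp flip: repr_Times repr_Smult
        intro!: repr_cong pres_eq.times_smult)
qed

section \<open>Evaluation of expressions and the universal property\<close>

context
  fixes P :: "('r, 'b, 'd) module_scheme" and f :: "('r, 'a) elem \<Rightarrow> 'b"
  assumes module: "module R P"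
    and algebra: "One \<in> T \<Longrightarrow> algebra R P"
    and gen_closed: "\<And>x. Gen x \<in> T \<Longrightarrow> f x \<in> carrier P"
begin

text \<open>Structural induction on the datatype works because \<open>no_junk\<close> excludes from
  \<open>T\<close> the constructors on which \<open>evaluate\<close> is unspecified.\<close>

lemma evaluate_closed: "t \<in> T \<Longrightarrow> evaluate P f t \<in> carrier P"
proof (induction t)
  case One
  then interpret algebra R P
    using algebra by blast
  show ?case by simp
next
  case (Times s t)
  then interpret algebra R P
    using algebra by simp
  show ?case using Times by simp
qed (use module gen_closed in
    \<open>auto intro: module.smult_closed abelian_monoid.a_closed abelian_monoid.zero_closed
      simp: module_def abelian_group_def\<close>)

context
  assumes rel: "\<And>s t. E s t \<Longrightarrow> evaluate P f s = evaluate P f t"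
begin

text \<open>Every clause of the congruence is a law of \<open>P\<close>. A clause about a product in
  \<open>T\<close> forces \<open>One \<in> T\<close>, hence \<open>P\<close> is then an algebra and
  not merely a module.\<close>

lemma evaluate_cong: "pres_eq R T E s t \<Longrightarrow> evaluate P f s = evaluate P f t"
proof (induction rule: pres_eq.induct)
  case (plus_neg s)
  interpret module R P by (rule module)
  show ?case
    using plus_neg by (simp add: evaluate_closed smult_l_minus M.l_neg)
next
  case (times_assoc s t u)
  then interpret algebra R P
    using algebra by simp
  show ?case
    using times_assoc by (simp add: evaluate_closed m_assoc)
next
  case (times_comm s t)
  then interpret algebra R P
    using algebra by simp
  show ?case
    using times_comm by (simp add: evaluate_closed m_comm)
next
  case (times_one s)
  then interpret algebra R P
    using algebra by simp
  show ?case
    using times_one by (simp add: evaluate_closed)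
next
  case (times_plus s t u)
  then interpret algebra R P
    using algebra by simp
  show ?case
    using times_plus by (simp add: evaluate_closed l_distr)
next
  case (times_smult r s t)
  then interpret algebra R P
    using algebra by simp
  show ?case
    using times_smult by (simp add: evaluate_closed smult_assoc2)
qed (use module rel in \<open>auto simp: evaluate_closed module.smult_l_distr module.smult_r_distr
      module.smult_assoc1 module.smult_one abelian_group_def abelian_monoid.a_ac
      abelian_monoid.l_zero module_def\<close>)

text \<open>Elements of \<open>Q\<close> are themselves expressions, so \<open>evaluate\<close>
  applies to them as it stands; this is its independence of the chosen representative.\<close>

lemma evaluate_repr: "t \<in> T \<Longrightarrow> evaluate P f (repr R T E t) = evaluate P f t"
  using evaluate_cong[OF eq_repr] by simp

lemma evaluate_lin_hom: "evaluate P f \<in> lin_hom R Q P"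
  by (rule lin_homI)
    (auto elim!: carrier_cases simp: evaluate_repr evaluate_closed simp flip: repr_simps)

lemma evaluate_mult:
  "One \<in> T \<Longrightarrow> x \<in> carrier Q \<Longrightarrow> y \<in> carrier Q \<Longrightarrow>
    evaluate P f (x \<otimes>\<^bsub>Q\<^esub> y) = evaluate P f x \<otimes>\<^bsub>P\<^esub> evaluate P f y"
  by (auto elim!: carrier_cases simp: evaluate_repr simp flip: repr_simps)

lemma evaluate_one: "One \<in> T \<Longrightarrow> evaluate P f \<one>\<^bsub>Q\<^esub> = \<one>\<^bsub>P\<^esub>"
  by (simp add: evaluate_repr flip: repr_One)

end

end

end

section \<open>Tensor products\<close>

lemma tensor_terms_simps [simp]:
  "Gen x \<in> tensor_terms R M N \<longleftrightarrow> (\<exists>m\<in>carrier M. \<exists>n\<in>carrier N. x = Duo m n)"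
  "Zero \<in> tensor_terms R M N"
  "One \<notin> tensor_terms R M N"
  "Plus s t \<in> tensor_terms R M N \<longleftrightarrow> s \<in> tensor_terms R M N \<and> t \<in> tensor_terms R M N"
  "Times s t \<notin> tensor_terms R M N"
  "Smult r s \<in> tensor_terms R M N \<longleftrightarrow> r \<in> carrier R \<and> s \<in> tensor_terms R M N"
  "Atom a \<notin> tensor_terms R M N"
  "Family g \<notin> tensor_terms R M N"
  "Duo s t \<notin> tensor_terms R M N"
  by (subst tensor_terms.simps; auto)+

lemma tensor_presentation:
  assumes "module R M" "module R N"
  shows "presentation R (tensor_terms R M N) (tensor_rel R M N)"
proof -
  interpret M: module R M by fact
  interpret N: module R N by fact
  show ?thesis
    by unfold_locales (auto elim!: tensor_rel.cases)
qed

lemma tensor_module: "module R M \<Longrightarrow> module R N \<Longrightarrow> module R (tensor R M N)"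
  unfolding tensor_def by (intro presentation.presented_module tensor_presentation)

text \<open>The four clauses of \<open>tensor_rel\<close> are the four laws of bilinearity.\<close>

lemma pure_bilin:
  assumes "module R M" "module R N"
  shows "pure R M N \<in> bilin_map R M N (tensor R M N)"
proof -
  interpret M: module R M by fact
  interpret N: module R N by fact
  interpret presentation R "tensor_terms R M N" "tensor_rel R M N"
    using assms by (rule tensor_presentation)
  show ?thesis
    unfolding pure_def tensor_def
    by (intro bilin_mapI lin_homI)
      (auto simp: simp flip: repr_simps
        intro!: repr_cong pres_eq.rel tensor_rel.intros)
qed

lemmas pure_closed = lin_hom_closed[OF bilin_map_right[OF pure_bilin]]

context
  fixes R :: "('r, 'c) ring_scheme" and M N :: "('r, 'a) obj" and P :: "('r, 'b, 'd) module_scheme"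
    and f :: "('r, 'a) elem \<Rightarrow> ('r, 'a) elem \<Rightarrow> 'b"
  assumes M: "module R M" and N: "module R N" and P: "module R P"
    and f: "f \<in> bilin_map R M N P"
begin

interpretation presentation R "tensor_terms R M N" "tensor_rel R M N"
  using M N by (rule tensor_presentation)

lemma tensor_evaluate_rel:
  assumes "tensor_rel R M N s t"
  shows "evaluate P (\<lambda>x. f (left x) (right x)) s = evaluate P (\<lambda>x. f (left x) (right x)) t"
  using assms by cases
    (auto simp: lin_hom_add[OF bilin_map_left[OF f]] lin_hom_add[OF bilin_map_right[OF f]]
      lin_hom_smult[OF bilin_map_left[OF f]] lin_hom_smult[OF bilin_map_right[OF f]])

lemma tensor_evaluate_gen:
  "Gen x \<in> tensor_terms R M N \<Longrightarrow> f (left x) (right x) \<in> carrier P"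
  by (auto simp: lin_hom_closed[OF bilin_map_right[OF f]])

lemma tensor_lift_hom: "tensor_lift P f \<in> lin_hom R (tensor R M N) P"
  unfolding tensor_lift_def tensor_def using P
  by (rule evaluate_lin_hom) (auto simp: tensor_evaluate_gen tensor_evaluate_rel)

lemma tensor_lift_pure:
  assumes "m \<in> carrier M" "n \<in> carrier N"
  shows "tensor_lift P f (pure R M N m n) = f m n"
proof -
  have "tensor_lift P f (pure R M N m n) = evaluate P (\<lambda>x. f (left x) (right x)) (Gen (Duo m n))"
    unfolding tensor_lift_def pure_def using P
    by (rule evaluate_repr)
      (use assms in \<open>simp_all add: tensor_evaluate_rel tensor_evaluate_gen
          del: tensor_terms_simps(1)\<close>, simp)
  then show ?thesis by simp
qed

end

text \<open>Induction over expressions, whose generators are the pure tensors. It takes the place of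
  writing elements as finite sums of pure tensors, and lets unknown values of \<open>b\<close> be
  handled.\<close>

lemma tensor_ext:
  assumes M: "module R M" and N: "module R N" and P: "module R P"
    and f: "f \<in> lin_hom R (tensor R M N) P" and g: "g \<in> lin_hom R (tensor R M N) P"
    and eq: "\<And>m n. m \<in> carrier M \<Longrightarrow> n \<in> carrier N \<Longrightarrow> f (pure R M N m n) = g (pure R M N m n)"
    and x: "x \<in> carrier (tensor R M N)"
  shows "f x = g x"
proof -
  interpret presentation R "tensor_terms R M N" "tensor_rel R M N"
    using M N by (rule tensor_presentation)
  note T = tensor_module[OF M N]
  have "f (repr R (tensor_terms R M N) (tensor_rel R M N) t) =
      g (repr R (tensor_terms R M N) (tensor_rel R M N) t)" if "t \<in> tensor_terms R M N" for t
    using that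
  proof induction
    case (1 m n)
    then show ?case
      using eq by (simp add: pure_def)
  qed (simp_all add: repr_simps lin_hom_zero[OF T P f, unfolded tensor_def]
      lin_hom_zero[OF T P g, unfolded tensor_def] lin_hom_add[OF f, unfolded tensor_def]
      lin_hom_add[OF g, unfolded tensor_def] lin_hom_smult[OF f, unfolded tensor_def]
      lin_hom_smult[OF g, unfolded tensor_def])
  then show ?thesis
    using x by (auto simp: tensor_def elim: carrier_cases)
qed

text \<open>For fixed \<open>x\<close>, linearity in \<open>n\<close> is an identity between linear
  maps in \<open>x\<close>, so it can be checked on pure tensors, where it is \<open>F'\<close>.
  Both associators are lifts of such lifts.\<close>

lemma tensor_lift_family:
  assumes L: "module R L" and M: "module R M" and N: "module R N" and P: "module R P"
    and F: "\<And>n. n \<in> carrier N \<Longrightarrow> F n \<in> bilin_map R L M P"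
    and F': "\<And>l m. l \<in> carrier L \<Longrightarrow> m \<in> carrier M \<Longrightarrow> (\<lambda>n. F n l m) \<in> lin_hom R N P"
  shows "(\<lambda>x n. tensor_lift P (F n) x) \<in> bilin_map R (tensor R L M) N P"
proof (rule bilin_mapI)
  note hom = tensor_lift_hom[OF L M P F] and pure = tensor_lift_pure[OF L M P F]
  interpret N: module R N by fact
  fix x assume x: "x \<in> carrier (tensor R L M)"
  show "(\<lambda>n. tensor_lift P (F n) x) \<in> lin_hom R N P"
  proof (rule lin_homI)
    fix n n' assume n: "n \<in> carrier N" "n' \<in> carrier N"
    show "tensor_lift P (F (n \<oplus>\<^bsub>N\<^esub> n')) x = tensor_lift P (F n) x \<oplus>\<^bsub>P\<^esub> tensor_lift P (F n') x"
      using N.a_closed[OF n] n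
      by (intro tensor_ext[OF L M P _ _ _ x, where f = "tensor_lift P (F (n \<oplus>\<^bsub>N\<^esub> n'))"]
          lin_hom_sum[OF P] hom) (simp_all add: pure lin_hom_add[OF F'])
  next
    fix r n assume n: "r \<in> carrier R" "n \<in> carrier N"
    show "tensor_lift P (F (r \<odot>\<^bsub>N\<^esub> n)) x = r \<odot>\<^bsub>P\<^esub> tensor_lift P (F n) x"
      using N.smult_closed[OF n] n
      by (intro tensor_ext[OF L M P _ _ _ x, where f = "tensor_lift P (F (r \<odot>\<^bsub>N\<^esub> n))"]
          lin_hom_scale[OF P] hom) (simp_all add: pure lin_hom_smult[OF F'])
  qed (rule lin_hom_closed[OF hom x])
qed (simp add: tensor_lift_hom[OF L M P F])

section \<open>Structural maps between tensor products\<close>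

context
  fixes R :: "('r, 'c) ring_scheme" and M N M' N' :: "('r, 'a) obj" and f g :: "('r, 'a) fn"
  assumes mods: "module R M" "module R N" "module R M'" "module R N'"
    and f: "f \<in> lin_hom R M M'" and g: "g \<in> lin_hom R N N'"
begin

private lemma bilin: "(\<lambda>m n. pure R M' N' (f m) (g n)) \<in> bilin_map R M N (tensor R M' N')"
  using pure_bilin[OF mods(3,4)] f g by (rule bilin_map_compose)

lemma tensor_map_hom: "tensor_map R M' N' f g \<in> lin_hom R (tensor R M N) (tensor R M' N')"
  unfolding tensor_map_def by (intro tensor_lift_hom mods tensor_module bilin)

lemma tensor_map_pure:
  "m \<in> carrier M \<Longrightarrow> n \<in> carrier N \<Longrightarrow>
    tensor_map R M' N' f g (pure R M N m n) = pure R M' N' (f m) (g n)"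
  unfolding tensor_map_def
  by (rule tensor_lift_pure[OF mods(1,2) tensor_module[OF mods(3,4)] bilin])

end

context
  fixes R :: "('r, 'c) ring_scheme" and M N :: "('r, 'a) obj"
  assumes mods: "module R M" "module R N"
begin

lemma braid_hom: "braid R M N \<in> lin_hom R (tensor R M N) (tensor R N M)"
  unfolding braid_def
  by (rule tensor_lift_hom[OF mods tensor_module[OF mods(2,1)]
        bilin_map_swap[OF pure_bilin[OF mods(2,1)]]])

lemma braid_pure:
  "m \<in> carrier M \<Longrightarrow> n \<in> carrier N \<Longrightarrow> braid R M N (pure R M N m n) = pure R N M n m"
  unfolding braid_def
  by (rule tensor_lift_pure[OF mods tensor_module[OF mods(2,1)]
        bilin_map_swap[OF pure_bilin[OF mods(2,1)]]])

end

context
  fixes R :: "('r, 'c) ring_scheme" and L M N :: "('r, 'a) obj"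
  assumes mods: "module R L" "module R M" "module R N"
begin

private lemma right_bilin:
  assumes "n \<in> carrier N"
  shows "(\<lambda>l m. pure R L (tensor R M N) l (pure R M N m n))
    \<in> bilin_map R L M (tensor R L (tensor R M N))"
  by (rule bilin_map_compose[OF pure_bilin lin_hom_id[unfolded id_def]
        bilin_map_left[OF pure_bilin]])
    (simp_all add: assms mods tensor_module)

private lemma right_family:
  "(\<lambda>x n. tensor_lift (tensor R L (tensor R M N))
      (\<lambda>l m. pure R L (tensor R M N) l (pure R M N m n)) x)
    \<in> bilin_map R (tensor R L M) N (tensor R L (tensor R M N))"
  by (rule tensor_lift_family)
    (simp_all add: mods tensor_module right_bilin
      lin_hom_compose[OF bilin_map_right[OF pure_bilin] bilin_map_right[OF pure_bilin]])

lemma assoc_right_hom: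
  "assoc_right R L M N \<in> lin_hom R (tensor R (tensor R L M) N) (tensor R L (tensor R M N))"
  unfolding assoc_right_def Let_def by (intro tensor_lift_hom mods tensor_module right_family)

lemma assoc_right_pure:
  assumes "l \<in> carrier L" "m \<in> carrier M" "n \<in> carrier N"
  shows "assoc_right R L M N (pure R (tensor R L M) N (pure R L M l m) n) =
    pure R L (tensor R M N) l (pure R M N m n)"
  unfolding assoc_right_def Let_def
  using assms
  by (simp add: tensor_lift_pure[OF _ _ _ right_family] tensor_lift_pure[OF _ _ _ right_bilin]
      mods tensor_module pure_closed)

private lemma left_bilin:
  assumes "l \<in> carrier L"
  shows "(\<lambda>m n. pure R (tensor R L M) N (pure R L M l m) n)
    \<in> bilin_map R M N (tensor R (tensor R L M) N)"
  by (rule bilin_map_compose[OF pure_bilin bilin_map_right[OF pure_bilin]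
        lin_hom_id[unfolded id_def]])
    (simp_all add: assms mods tensor_module)

private lemma left_family:
  "(\<lambda>l x. tensor_lift (tensor R (tensor R L M) N)
      (\<lambda>m n. pure R (tensor R L M) N (pure R L M l m) n) x)
    \<in> bilin_map R L (tensor R M N) (tensor R (tensor R L M) N)"
  \<comment> \<open>The lifted tensor product is the second argument here, so the arguments are
    exchanged before the family is applied.\<close>
  by (rule bilin_map_swap, rule tensor_lift_family)
    (simp_all add: mods tensor_module left_bilin
      lin_hom_compose[OF bilin_map_left[OF pure_bilin] bilin_map_left[OF pure_bilin]])

lemma assoc_left_hom:
  "assoc_left R L M N \<in> lin_hom R (tensor R L (tensor R M N)) (tensor R (tensor R L M) N)"
  unfolding assoc_left_def Let_def by (intro tensor_lift_hom mods tensor_module left_family)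

lemma assoc_left_pure:
  assumes "l \<in> carrier L" "m \<in> carrier M" "n \<in> carrier N"
  shows "assoc_left R L M N (pure R L (tensor R M N) l (pure R M N m n)) =
    pure R (tensor R L M) N (pure R L M l m) n"
  unfolding assoc_left_def Let_def
  using assms
  by (simp add: tensor_lift_pure[OF _ _ _ left_family] tensor_lift_pure[OF _ _ _ left_bilin]
      mods tensor_module pure_closed)

end

section \<open>Symmetric algebras and their derivations\<close>

lemma sym_terms_simps [simp]:
  "Gen x \<in> sym_terms R N \<longleftrightarrow> x \<in> carrier N"
  "Zero \<in> sym_terms R N"
  "One \<in> sym_terms R N"
  "Plus s t \<in> sym_terms R N \<longleftrightarrow> s \<in> sym_terms R N \<and> t \<in> sym_terms R N"
  "Times s t \<in> sym_terms R N \<longleftrightarrow> s \<in> sym_terms R N \<and> t \<in> sym_terms R N"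
  "Smult r s \<in> sym_terms R N \<longleftrightarrow> r \<in> carrier R \<and> s \<in> sym_terms R N"
  "Atom a \<notin> sym_terms R N"
  "Family g \<notin> sym_terms R N"
  "Duo s t \<notin> sym_terms R N"
  by (subst sym_terms.simps; auto)+

lemma sym_presentation:
  assumes "module R N"
  shows "presentation R (sym_terms R N) (sym_rel R N)"
proof -
  interpret N: module R N by fact
  show ?thesis
    by unfold_locales (auto elim!: sym_rel.cases)
qed

context
  fixes R :: "('r, 'c) ring_scheme" and N :: "('r, 'a) obj"
  assumes N: "module R N"
begin

interpretation presentation R "sym_terms R N" "sym_rel R N"
  using N by (rule sym_presentation)

lemma sym_algebra: "algebra R (Sym R N)"
  unfolding Sym_def by (rule presented_algebra) simp

lemma sym_module: "module R (Sym R N)"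
  by (rule algebra.module[OF sym_algebra])

lemma sym_carrier_cases:
  assumes "x \<in> carrier (Sym R N)"
  obtains t where "t \<in> sym_terms R N" "x = sym_repr R N t"
  using assms unfolding Sym_def sym_repr_def by (rule carrier_cases)

lemma sym_repr_carrier: "t \<in> sym_terms R N \<Longrightarrow> sym_repr R N t \<in> carrier (Sym R N)"
  by (simp add: Sym_def sym_repr_def)

lemmas sym_repr_simps = repr_simps[folded sym_repr_def Sym_def, simplified]

lemma sym_repr_cong: "pres_eq R (sym_terms R N) (sym_rel R N) s t \<Longrightarrow> sym_repr R N s = sym_repr R N t"
  unfolding sym_repr_def by (rule repr_cong)

text \<open>The two clauses of \<open>sym_rel\<close> impose exactly additivity and homogeneity on
  the generators.\<close>

lemma sym_eta_hom: "sym_eta R N \<in> lin_hom R N (Sym R N)"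
proof (rule lin_homI)
  fix r x assume "r \<in> carrier R" "x \<in> carrier N"
  then show "sym_eta R N (r \<odot>\<^bsub>N\<^esub> x) = r \<odot>\<^bsub>Sym R N\<^esub> sym_eta R N x"
    by (auto simp: sym_eta_def simp flip: sym_repr_simps
        intro!: sym_repr_cong pres_eq.rel sym_rel.intros)
next
  fix x y assume "x \<in> carrier N" "y \<in> carrier N"
  then show "sym_eta R N (x \<oplus>\<^bsub>N\<^esub> y) = sym_eta R N x \<oplus>\<^bsub>Sym R N\<^esub> sym_eta R N y"
    by (auto simp: sym_eta_def simp flip: sym_repr_simps
        intro!: sym_repr_cong pres_eq.rel sym_rel.intros)
qed (simp add: sym_eta_def sym_repr_carrier)

context
  fixes A :: "('r, 'b, 'd) module_scheme" and f :: "('r, 'a) elem \<Rightarrow> 'b"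
  assumes A: "algebra R A" and f: "f \<in> lin_hom R N A"
begin

private lemma f_rel: "sym_rel R N s t \<Longrightarrow> evaluate A f s = evaluate A f t"
  by (auto elim!: sym_rel.cases simp: lin_hom_add[OF f] lin_hom_smult[OF f])

private lemma f_closed: "Gen x \<in> sym_terms R N \<Longrightarrow> f x \<in> carrier A"
  by (simp add: lin_hom_closed[OF f])

lemma evaluate_sym_hom: "evaluate A f \<in> lin_hom R (Sym R N) A"
  unfolding Sym_def by (rule evaluate_lin_hom[OF algebra.module[OF A] A f_closed f_rel])

lemma evaluate_sym_mult:
  "x \<in> carrier (Sym R N) \<Longrightarrow> y \<in> carrier (Sym R N) \<Longrightarrow>
    evaluate A f (x \<otimes>\<^bsub>Sym R N\<^esub> y) = evaluate A f x \<otimes>\<^bsub>A\<^esub> evaluate A f y"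
  unfolding Sym_def by (rule evaluate_mult[OF algebra.module[OF A] A f_closed f_rel]) simp_all

lemma evaluate_sym_one: "evaluate A f \<one>\<^bsub>Sym R N\<^esub> = \<one>\<^bsub>A\<^esub>"
  unfolding Sym_def by (rule evaluate_one[OF algebra.module[OF A] A f_closed f_rel]) simp_all

lemma evaluate_sym_eta: "x \<in> carrier N \<Longrightarrow> evaluate A f (sym_eta R N x) = f x"
  unfolding sym_eta_def sym_repr_def
  by (subst evaluate_repr[OF algebra.module[OF A] A f_closed f_rel]) simp_all

end

section \<open>Derivations of a symmetric algebra\<close>

context
  fixes d :: "('r, 'a) fn"
  assumes d: "d \<in> lin_hom R N (Sym R N)"
begin

private abbreviation "\<delta> \<equiv> sym_derivation R N d"

interpretation S: algebra R "Sym R N"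
  by (rule sym_algebra)

private lemma derivation_closed: "t \<in> sym_terms R N \<Longrightarrow> \<delta> t \<in> carrier (Sym R N)"
  by (induction t) (auto simp: lin_hom_closed[OF d] sym_repr_carrier)

text \<open>The Leibniz clause multiplies by \<open>sym_repr\<close> of the undifferentiated factor,
  which is already invariant under the congruence; what remains are identities in the commutative
  algebra \<open>Sym R N\<close>.\<close>

lemma sym_derivation_cong:
  "pres_eq R (sym_terms R N) (sym_rel R N) s t \<Longrightarrow> \<delta> s = \<delta> t"
proof (induction rule: pres_eq.induct)
  case (rel s t)
  then show ?case
    by (auto elim!: sym_rel.cases simp: lin_hom_add[OF d] lin_hom_smult[OF d])
next
  case (times_cong s t s' t')
  then show ?case
    by (simp add: sym_repr_cong)
next
  case (plus_neg s)
  then show ?case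
    by (simp add: derivation_closed S.smult_l_minus S.M.l_neg)
next
  case (times_smult r s t)
  then show ?case
    by (simp add: derivation_closed sym_repr_carrier sym_repr_simps S.smult_assoc2 S.smult_r_distr)
next
  case (times_one s)
  then show ?case
    by (simp add: derivation_closed sym_repr_carrier sym_repr_simps)
next
  case (times_comm s t)
  then show ?case
    by (simp add: derivation_closed sym_repr_carrier S.m_comm S.M.a_comm)
next
  case (times_plus s t u)
  then show ?case
    by (simp add: derivation_closed sym_repr_carrier sym_repr_simps S.l_distr S.M.a_ac)
next
  case (times_assoc s t u)
  then show ?case
    by (simp add: derivation_closed sym_repr_carrier sym_repr_simps S.l_distr S.r_distr
        S.m_assoc S.M.a_ac)
qed (simp_all add: derivation_closed S.M.a_ac S.smult_l_distr S.smult_r_distr S.smult_assoc1)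

lemma sym_derivation_repr: "t \<in> sym_terms R N \<Longrightarrow> \<delta> (sym_repr R N t) = \<delta> t"
  unfolding sym_repr_def using sym_derivation_cong[OF eq_repr] by simp

lemma sym_derivation_hom: "\<delta> \<in> lin_hom R (Sym R N) (Sym R N)"
  by (rule lin_homI)
    (auto elim!: sym_carrier_cases simp: derivation_closed sym_derivation_repr
      simp flip: sym_repr_simps)

lemma sym_derivation_mult:
  assumes "x \<in> carrier (Sym R N)" "y \<in> carrier (Sym R N)"
  shows "\<delta> (x \<otimes>\<^bsub>Sym R N\<^esub> y) = \<delta> x \<otimes>\<^bsub>Sym R N\<^esub> y \<oplus>\<^bsub>Sym R N\<^esub> x \<otimes>\<^bsub>Sym R N\<^esub> \<delta> y"
  using assms
  by (auto elim!: sym_carrier_cases simp: sym_derivation_repr simp flip: sym_repr_simps(3))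

lemma sym_derivation_eta: "x \<in> carrier N \<Longrightarrow> \<delta> (sym_eta R N x) = d x"
  by (simp add: sym_eta_def sym_derivation_repr)

end

end

section \<open>Functor and multiplication of the symmetric algebra monad\<close>

lemma sym_map_hom:
  assumes "module R N" "module R N'" "f \<in> lin_hom R N N'"
  shows "sym_map R N' f \<in> lin_hom R (Sym R N) (Sym R N')"
  unfolding sym_map_def
  by (intro evaluate_sym_hom assms sym_algebra lin_hom_fcomp[OF assms(3)] sym_eta_hom)

lemma sym_map_eta:
  assumes "module R N" "module R N'" "f \<in> lin_hom R N N'" "x \<in> carrier N"
  shows "sym_map R N' f (sym_eta R N x) = sym_eta R N' (f x)"
  unfolding sym_map_def
  by (simp add: evaluate_sym_eta[OF assms(1) sym_algebra[OF assms(2)]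
        lin_hom_fcomp[OF assms(3) sym_eta_hom[OF assms(2)]] assms(4)])

lemma sym_mu_hom:
  assumes "module R N"
  shows "sym_mu R N \<in> lin_hom R (Sym R (Sym R N)) (Sym R N)"
  unfolding sym_mu_def by (intro evaluate_sym_hom assms sym_algebra sym_module lin_hom_id)

lemma sym_mu_eta:
  assumes "module R N" "x \<in> carrier (Sym R N)"
  shows "sym_mu R N (sym_eta R (Sym R N) x) = x"
  unfolding sym_mu_def
  by (simp add: evaluate_sym_eta[OF sym_module[OF assms(1)] sym_algebra[OF assms(1)]
        lin_hom_id assms(2)])

section \<open>Countable copowers\<close>

lemma dsum_simps [simp]:
  "carrier (dsum M) = {Family f |f. (\<forall>n. f n \<in> carrier M) \<and> finite {n. f n \<noteq> \<zero>\<^bsub>M\<^esub>}}"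
  "\<zero>\<^bsub>dsum M\<^esub> = Family (\<lambda>n. \<zero>\<^bsub>M\<^esub>)"
  "x \<oplus>\<^bsub>dsum M\<^esub> y = Family (\<lambda>n. component x n \<oplus>\<^bsub>M\<^esub> component y n)"
  "r \<odot>\<^bsub>dsum M\<^esub> x = Family (\<lambda>n. r \<odot>\<^bsub>M\<^esub> component x n)"
  by (simp_all add: dsum_def)

lemma dsum_module:
  assumes "module R M"
  shows "module R (dsum M)"
proof -
  interpret M: module R M by fact
  have plus: "finite {n. f n \<oplus>\<^bsub>M\<^esub> g n \<noteq> \<zero>\<^bsub>M\<^esub>}"
    if "finite {n. f n \<noteq> \<zero>\<^bsub>M\<^esub>}" "finite {n. g n \<noteq> \<zero>\<^bsub>M\<^esub>}" for f g
    by (rule finite_subset[OF _ finite_UnI[OF that]]) auto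
  have smult: "finite {n. r \<odot>\<^bsub>M\<^esub> f n \<noteq> \<zero>\<^bsub>M\<^esub>}"
    if "finite {n. f n \<noteq> \<zero>\<^bsub>M\<^esub>}" "r \<in> carrier R" for f :: "nat \<Rightarrow> _" and r
    by (rule finite_subset[OF _ that(1)]) (use that(2) in auto)
  show ?thesis
  proof (rule moduleI)
    show "abelian_group (dsum M)"
    proof (rule abelian_groupI)
      fix x assume "x \<in> carrier (dsum M)"
      then show "\<exists>y\<in>carrier (dsum M). y \<oplus>\<^bsub>dsum M\<^esub> x = \<zero>\<^bsub>dsum M\<^esub>"
        using smult[of _ "\<ominus>\<^bsub>R\<^esub> \<one>\<^bsub>R\<^esub>"]
        by (intro bexI[of _ "(\<ominus>\<^bsub>R\<^esub> \<one>\<^bsub>R\<^esub>) \<odot>\<^bsub>dsum M\<^esub> x"])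
          (auto simp: M.smult_l_minus M.M.l_neg)
    qed (auto simp: M.M.a_ac plus)
  qed (auto simp: M.is_cring smult M.smult_l_distr M.smult_r_distr M.smult_assoc1)
qed

context
  fixes R :: "('r, 'c) ring_scheme" and M :: "('r, 'a) obj"
  assumes M: "module R M"
begin

interpretation M: module R M by (rule M)

lemma dsum_in_hom: "dsum_in M k \<in> lin_hom R M (dsum M)"
proof (rule lin_homI)
  fix x assume "x \<in> carrier M"
  then show "dsum_in M k x \<in> carrier (dsum M)"
    by (auto simp: dsum_in_def intro: finite_subset[of _ "{k}"])
qed (auto simp: dsum_in_def)

text \<open>Outside the support each summand is \<open>g n\<close> of zero, hence zero. The freedom
  in \<open>S\<close> allows one common index set for two elements and their sum, whose supports
  differ.\<close>

lemma dsum_copair_cong: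
  assumes "module R P" and g: "\<And>k. g k \<in> lin_hom R M P" and x: "x \<in> carrier (dsum M)"
    and S: "finite S" "{n. component x n \<noteq> \<zero>\<^bsub>M\<^esub>} \<subseteq> S"
  shows "dsum_copair M P g x = (\<Oplus>\<^bsub>P\<^esub>n\<in>S. g n (component x n))"
proof -
  interpret P: module R P by fact
  show ?thesis
    unfolding dsum_copair_def
    using x S by (intro P.M.add.finprod_mono_neutral_cong_left)
      (auto simp: lin_hom_zero[OF M assms(1) g] lin_hom_closed[OF g])
qed

lemma dsum_copair_hom:
  assumes P: "module R P" and g: "\<And>k. g k \<in> lin_hom R M P"
  shows "dsum_copair M P g \<in> lin_hom R (dsum M) P"
proof -
  interpret P: module R P by fact
  interpret S: module R "dsum M"
    using M by (rule dsum_module)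
  note c = dsum_copair_cong[OF P g]
  have gc: "(\<lambda>n. g n (component x n)) \<in> S \<rightarrow> carrier P" if "x \<in> carrier (dsum M)" for x S
    using that by (auto simp: lin_hom_closed[OF g])
  show ?thesis
  proof (rule lin_homI)
    fix x assume "x \<in> carrier (dsum M)"
    then show "dsum_copair M P g x \<in> carrier P"
      unfolding dsum_copair_def by (intro P.finsum_closed gc)
  next
    fix x y assume xy: "x \<in> carrier (dsum M)" "y \<in> carrier (dsum M)"
    define S where "S = {n. component x n \<noteq> \<zero>\<^bsub>M\<^esub>} \<union> {n. component y n \<noteq> \<zero>\<^bsub>M\<^esub>}"
    have S: "finite S" using xy by (auto simp: S_def)
    have "dsum_copair M P g (x \<oplus>\<^bsub>dsum M\<^esub> y) =
        (\<Oplus>\<^bsub>P\<^esub>n\<in>S. g n (component (x \<oplus>\<^bsub>dsum M\<^esub> y) n))"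
      by (rule c[OF S.a_closed[OF xy] S]) (auto simp: S_def)
    also have "\<dots> = (\<Oplus>\<^bsub>P\<^esub>n\<in>S. g n (component x n) \<oplus>\<^bsub>P\<^esub> g n (component y n))"
      by (rule P.finsum_cong')
        (use xy in \<open>auto simp: lin_hom_add[OF g] lin_hom_closed[OF g]\<close>)
    also have "\<dots> = (\<Oplus>\<^bsub>P\<^esub>n\<in>S. g n (component x n)) \<oplus>\<^bsub>P\<^esub> (\<Oplus>\<^bsub>P\<^esub>n\<in>S. g n (component y n))"
      by (rule P.finsum_addf[OF gc[OF xy(1)] gc[OF xy(2)]])
    also have "\<dots> = dsum_copair M P g x \<oplus>\<^bsub>P\<^esub> dsum_copair M P g y"
      by (subst (1 2) c[OF _ S]) (use xy in \<open>auto simp: S_def\<close>)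
    finally show "dsum_copair M P g (x \<oplus>\<^bsub>dsum M\<^esub> y) =
        dsum_copair M P g x \<oplus>\<^bsub>P\<^esub> dsum_copair M P g y" .
  next
    fix r x assume rx: "r \<in> carrier R" "x \<in> carrier (dsum M)"
    define S where "S = {n. component x n \<noteq> \<zero>\<^bsub>M\<^esub>}"
    have S: "finite S" using rx by (auto simp: S_def)
    have "dsum_copair M P g (r \<odot>\<^bsub>dsum M\<^esub> x) = (\<Oplus>\<^bsub>P\<^esub>n\<in>S. g n (component (r \<odot>\<^bsub>dsum M\<^esub> x) n))"
      by (rule c[OF S.smult_closed[OF rx] S]) (use rx in \<open>auto simp: S_def\<close>)
    also have "\<dots> = (\<Oplus>\<^bsub>P\<^esub>n\<in>S. r \<odot>\<^bsub>P\<^esub> g n (component x n))"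
      by (rule P.finsum_cong')
        (use rx in \<open>auto simp: lin_hom_smult[OF g] lin_hom_closed[OF g]\<close>)
    also have "\<dots> = r \<odot>\<^bsub>P\<^esub> (\<Oplus>\<^bsub>P\<^esub>n\<in>S. g n (component x n))"
      by (rule P.finsum_smult_ldistr[OF S rx(1) gc[OF rx(2)], symmetric])
    finally show "dsum_copair M P g (r \<odot>\<^bsub>dsum M\<^esub> x) = r \<odot>\<^bsub>P\<^esub> dsum_copair M P g x"
      by (simp add: dsum_copair_def S_def)
  qed
qed

lemma dsum_copair_in:
  assumes P: "module R P" and g: "\<And>k. g k \<in> lin_hom R M P" and m: "m \<in> carrier M"
  shows "dsum_copair M P g (dsum_in M k m) = g k m"
proof -
  interpret P: module R P by fact
  \<comment> \<open>The index set {k} also covers m = 0, where the support is empty.\<close>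
  have "dsum_copair M P g (dsum_in M k m) =
      (\<Oplus>\<^bsub>P\<^esub>n\<in>{k}. g n (component (dsum_in M k m) n))"
    by (rule dsum_copair_cong[OF P g lin_hom_closed[OF dsum_in_hom m]]) (auto simp: dsum_in_def)
  also have "\<dots> = g k m"
    using lin_hom_closed[OF g m] by (simp add: dsum_in_def)
  finally show ?thesis .
qed

end

text \<open>Supports can only shrink, because \<open>f\<close> preserves zero.\<close>

lemma dsum_map_hom:
  assumes M: "module R M" and N: "module R N" and f: "f \<in> lin_hom R M N"
  shows "dsum_map f \<in> lin_hom R (dsum M) (dsum N)"
proof (rule lin_homI)
  fix x assume "x \<in> carrier (dsum M)"
  then show "dsum_map f x \<in> carrier (dsum N)"
    by (auto simp: dsum_map_def lin_hom_closed[OF f] lin_hom_zero[OF M N f]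
        intro: rev_finite_subset)
qed (auto simp: dsum_map_def lin_hom_add[OF f] lin_hom_smult[OF f])

lemma dsum_map_in:
  assumes "module R M" "module R N" "f \<in> lin_hom R M N"
  shows "dsum_map f (dsum_in M k m) = dsum_in N k (f m)"
  by (auto simp: dsum_map_def dsum_in_def lin_hom_zero[OF assms])

section \<open>Free differential algebras\<close>

text \<open>The k-th derivative of the indeterminate attached to an element of \<open>M\<close>: k =
  0 gives the monad unit \<alpha>, and the derivation raises k by one
  (\<open>Diff_D_gen\<close>).\<close>

definition Diff_gen :: "('r, 'c) ring_scheme \<Rightarrow> ('r, 'a) obj \<Rightarrow> nat \<Rightarrow> ('r, 'a) fn"
  where "Diff_gen R M k = dsum_in M k \<circ>> sym_eta R (dsum M)"

context
  fixes R :: "('r, 'c) ring_scheme" and M :: "('r, 'a) obj"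
  assumes M: "module R M"
begin

lemma Diff_algebra: "algebra R (Diff_obj R M)"
  unfolding Diff_obj_def by (intro sym_algebra dsum_module M)

lemma Diff_module: "module R (Diff_obj R M)"
  by (rule algebra.module[OF Diff_algebra])

lemma Diff_gen_hom: "Diff_gen R M k \<in> lin_hom R M (Diff_obj R M)"
  unfolding Diff_gen_def Diff_obj_def
  by (rule lin_hom_fcomp[OF dsum_in_hom[OF M] sym_eta_hom[OF dsum_module[OF M]]])

private lemma shift_hom:
  "dsum_copair M (dsum M) (\<lambda>k. dsum_in M (Suc k)) \<circ>> sym_eta R (dsum M)
    \<in> lin_hom R (dsum M) (Sym R (dsum M))"
  by (rule lin_hom_fcomp[OF dsum_copair_hom sym_eta_hom]) (intro M dsum_module dsum_in_hom)+

lemma Diff_D_hom: "Diff_D R M \<in> lin_hom R (Diff_obj R M) (Diff_obj R M)"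
  unfolding Diff_D_def Diff_obj_def by (intro sym_derivation_hom shift_hom dsum_module M)

lemma Diff_D_mult:
  "x \<in> carrier (Diff_obj R M) \<Longrightarrow> y \<in> carrier (Diff_obj R M) \<Longrightarrow>
    Diff_D R M (x \<otimes>\<^bsub>Diff_obj R M\<^esub> y) =
      Diff_D R M x \<otimes>\<^bsub>Diff_obj R M\<^esub> y \<oplus>\<^bsub>Diff_obj R M\<^esub> x \<otimes>\<^bsub>Diff_obj R M\<^esub> Diff_D R M y"
  unfolding Diff_D_def Diff_obj_def by (rule sym_derivation_mult[OF dsum_module[OF M] shift_hom])

lemma Diff_D_gen:
  assumes "m \<in> carrier M"
  shows "Diff_D R M (Diff_gen R M k m) = Diff_gen R M (Suc k) m"
  using assms lin_hom_closed[OF dsum_in_hom[OF M] assms]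
  by (simp add: Diff_D_def Diff_gen_def sym_derivation_eta[OF dsum_module[OF M] shift_hom]
      dsum_copair_in[OF M dsum_module[OF M] dsum_in_hom[OF M]] del: dsum_simps)

lemma Diff_D_power_hom: "Diff_D R M ^^ k \<in> lin_hom R (Diff_obj R M) (Diff_obj R M)"
proof (induction k)
  case (Suc k)
  then show ?case
    using lin_hom_compose[OF Suc Diff_D_hom] by (simp add: comp_def)
qed (use lin_hom_id in \<open>simp add: id_def\<close>)

lemma Diff_psi_hom: "Diff_psi R M \<in> lin_hom R (dsum (Diff_obj R M)) (Diff_obj R M)"
  unfolding Diff_psi_def by (intro dsum_copair_hom Diff_module Diff_D_power_hom)

lemma Diff_nu_hom: "T_nu (Diff R) M \<in> lin_hom R (Diff_obj R (Diff_obj R M)) (Diff_obj R M)"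
proof -
  have "sym_mu R (dsum M) \<in> lin_hom R (Sym R (Diff_obj R M)) (Diff_obj R M)"
    unfolding Diff_obj_def by (intro sym_mu_hom dsum_module M)
  then show ?thesis
    unfolding Diff_def modality.simps Diff_obj_def[of R "Diff_obj R M"]
    by (rule lin_hom_fcomp[OF sym_map_hom[OF dsum_module[OF Diff_module] Diff_module Diff_psi_hom]])
qed

text \<open>On a generator, \<open>sym_map\<close> applies \<open>Diff_psi\<close> under \<eta> and
  \<mu> removes the \<eta>. The case k = 1 is the one that brings the derivation into the chain
  rule.\<close>

lemma Diff_nu_gen:
  assumes w: "w \<in> carrier (Diff_obj R M)"
  shows "T_nu (Diff R) M (Diff_gen R (Diff_obj R M) k w) = (Diff_D R M ^^ k) w"
proof -
  note A = Diff_module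
  have "Diff_psi R M (dsum_in (Diff_obj R M) k w) = (Diff_D R M ^^ k) w"
    unfolding Diff_psi_def by (rule dsum_copair_in[OF A A Diff_D_power_hom w])
  then show ?thesis
    using sym_map_eta[OF dsum_module[OF A] A Diff_psi_hom
        lin_hom_closed[OF dsum_in_hom[OF A] w], of k]
      sym_mu_eta[OF dsum_module[OF M]
        lin_hom_closed[OF Diff_D_power_hom[unfolded Diff_obj_def] w[unfolded Diff_obj_def]]]
    by (simp add: Diff_def Diff_gen_def Diff_obj_def del: dsum_simps)
qed

end

lemma Diff_map_hom:
  assumes "module R M" "module R N" "f \<in> lin_hom R M N"
  shows "T_map (Diff R) M N f \<in> lin_hom R (Diff_obj R M) (Diff_obj R N)"
  unfolding Diff_def Diff_obj_def modality.simps
  by (intro sym_map_hom dsum_module dsum_map_hom assms)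

lemma Diff_map_gen:
  assumes "module R M" "module R N" "f \<in> lin_hom R M N" "m \<in> carrier M"
  shows "T_map (Diff R) M N f (Diff_gen R M k m) = Diff_gen R N k (f m)"
  using sym_map_eta[OF dsum_module[OF assms(1)] dsum_module[OF assms(2)] dsum_map_hom[OF assms(1-3)]
      lin_hom_closed[OF dsum_in_hom[OF assms(1)] assms(4)]]
  by (simp add: Diff_def Diff_gen_def dsum_map_in[OF assms(1-3)] del: dsum_simps)

section \<open>A derivation at a point\<close>

lemma algebra_mult_bilin:
  assumes "algebra R A"
  shows "mult A \<in> bilin_map R A A A"
proof -
  interpret A: algebra R A by fact
  have "x \<otimes>\<^bsub>A\<^esub> (r \<odot>\<^bsub>A\<^esub> y) = r \<odot>\<^bsub>A\<^esub> (x \<otimes>\<^bsub>A\<^esub> y)"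
    if "r \<in> carrier R" "x \<in> carrier A" "y \<in> carrier A" for r x y
    using that A.smult_assoc2[of r y x] by (simp add: A.m_comm)
  then show ?thesis
    by (intro bilin_mapI lin_homI) (simp_all add: A.l_distr A.r_distr A.smult_assoc2)
qed

text \<open>
  A point \<open>\<chi>\<close> of the algebra \<open>Diff M\<close> and a linear form \<open>l\<close> on \<open>M\<close> turn a deriving
  transformation into the functional \<open>E\<close>, an \<open>R\<close>-valued derivation at \<open>\<chi>\<close>.
\<close>

locale pointed_deriving_transformation = deriving_transformation R "Diff R" b
  for R :: "('r, 'c) ring_scheme" and b :: "('r, 'a) obj \<Rightarrow> ('r, 'a) fn" +
  fixes M :: "('r, 'a) obj" and h l :: "('r, 'a) elem \<Rightarrow> 'r"
  assumes M: "module R M"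
    and h: "h \<in> lin_hom R (dsum M) (self_algebra R)"
    and l: "l \<in> lin_hom R M (self_algebra R)"
begin

sublocale R: cring R
  using M by (simp add: module_def)

abbreviation "A \<equiv> Diff_obj R M"
abbreviation "K \<equiv> self_algebra R"

definition "\<chi> = evaluate K h"
text \<open>This is \<chi> \<otimes> l followed by the multiplication R \<otimes> R \<rightarrow> R,
  lifted in one stage since \<open>K\<close> is not an object.\<close>

definition "L = tensor_lift K (\<lambda>s m. \<chi> s \<otimes>\<^bsub>R\<^esub> l m)"
definition "E = b M \<circ>> L"

lemma K: "module R K"
  by (intro module_self R.is_cring)

lemma A: "module R A"
  by (rule Diff_module[OF M])

lemmas K_alg = algebra_self[OF R.is_cring]

lemma chi_hom: "\<chi> \<in> lin_hom R A K"
  unfolding \<chi>_def Diff_obj_def by (rule evaluate_sym_hom[OF dsum_module[OF M] K_alg h])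

lemma chi_mult:
  "u \<in> carrier A \<Longrightarrow> v \<in> carrier A \<Longrightarrow> \<chi> (u \<otimes>\<^bsub>A\<^esub> v) = \<chi> u \<otimes>\<^bsub>R\<^esub> \<chi> v"
  using evaluate_sym_mult[OF dsum_module[OF M] K_alg h] by (simp add: \<chi>_def Diff_obj_def)

lemma chi_one: "\<chi> \<one>\<^bsub>A\<^esub> = \<one>\<^bsub>R\<^esub>"
  using evaluate_sym_one[OF dsum_module[OF M] K_alg h] by (simp add: \<chi>_def Diff_obj_def)

lemma chi_gen: "m \<in> carrier M \<Longrightarrow> \<chi> (Diff_gen R M k m) = h (dsum_in M k m)"
  using evaluate_sym_eta[OF dsum_module[OF M] K_alg h] lin_hom_closed[OF dsum_in_hom[OF M]]
  by (simp add: \<chi>_def Diff_gen_def del: dsum_simps)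

lemmas chi_closed = lin_hom_closed[OF chi_hom, simplified]
lemmas l_closed = lin_hom_closed[OF l, simplified]

lemma L_bilin: "(\<lambda>s m. \<chi> s \<otimes>\<^bsub>R\<^esub> l m) \<in> bilin_map R A M K"
  using bilin_map_compose[OF algebra_mult_bilin[OF K_alg] chi_hom l] by simp

lemma L_hom: "L \<in> lin_hom R (tensor R A M) K"
  unfolding L_def by (rule tensor_lift_hom[OF A M K L_bilin])

lemma L_pure: "s \<in> carrier A \<Longrightarrow> m \<in> carrier M \<Longrightarrow> L (pure R A M s m) = \<chi> s \<otimes>\<^bsub>R\<^esub> l m"
  unfolding L_def by (rule tensor_lift_pure[OF A M K L_bilin])

lemma b_hom: "module R N \<Longrightarrow> b N \<in> lin_hom R (Diff_obj R N) (tensor R (Diff_obj R N) N)"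
  using linear by (simp add: Diff_def)

lemma E_hom: "E \<in> lin_hom R A K"
  unfolding E_def by (rule lin_hom_fcomp[OF b_hom[OF M] L_hom])

lemmas E_closed = lin_hom_closed[OF E_hom, simplified]

section \<open>The product rule and the linear rule as identities of scalars\<close>

abbreviation "nabla \<equiv> T_nabla (Diff R) M"

lemma nabla_hom: "nabla \<in> lin_hom R (tensor R A A) A"
  unfolding Diff_def modality.simps
  by (rule tensor_lift_hom[OF A A A algebra_mult_bilin[OF Diff_algebra[OF M]]])

lemma nabla_pure: "u \<in> carrier A \<Longrightarrow> v \<in> carrier A \<Longrightarrow> nabla (pure R A A u v) = u \<otimes>\<^bsub>A\<^esub> v"
  unfolding Diff_def modality.simps
  by (rule tensor_lift_pure[OF A A A algebra_mult_bilin[OF Diff_algebra[OF M]]])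

abbreviation "AM \<equiv> tensor R A M"

lemma AM: "module R AM"
  by (rule tensor_module[OF A M])

text \<open>The product rule and the chain rule end in the same reassociation and multiplication;
  \<open>L'\<close> is this common tail followed by \<open>L\<close>.\<close>

definition "L' = assoc_left R A A M \<circ>> tensor_map R A M nabla id \<circ>> L"

lemma L'_hom: "L' \<in> lin_hom R (tensor R A AM) K"
  unfolding L'_def
  by (rule lin_hom_fcomp[OF lin_hom_fcomp[OF assoc_left_hom[OF A A M]
          tensor_map_hom[OF tensor_module[OF A A] M A M nabla_hom lin_hom_id]] L_hom])

lemma L'_pure_pure:
  assumes "p \<in> carrier A" "s \<in> carrier A" "m \<in> carrier M"
  shows "L' (pure R A AM p (pure R A M s m)) = \<chi> p \<otimes>\<^bsub>R\<^esub> (\<chi> s \<otimes>\<^bsub>R\<^esub> l m)"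
proof -
  interpret A: algebra R A by (rule Diff_algebra[OF M])
  show ?thesis
    using assms
    by (simp add: L'_def assoc_left_pure[OF A A M] nabla_pure L_pure chi_mult chi_closed l_closed
        tensor_map_pure[OF tensor_module[OF A A] M A M nabla_hom lin_hom_id]
        pure_closed[OF A A] R.m_assoc)
qed

text \<open>Needed for \<open>X\<close> a value of \<open>b M\<close>, which is not known to be
  pure. Both sides are linear in \<open>X\<close>, so pure \<open>X\<close> suffice, and there it is
  multiplicativity of \<chi>.\<close>

lemma L'_pure:
  assumes p: "p \<in> carrier A" and X: "X \<in> carrier AM"
  shows "L' (pure R A AM p X) = \<chi> p \<otimes>\<^bsub>R\<^esub> L X"
proof (rule tensor_ext[OF A M K _ _ _ X])
  show "(\<lambda>X. L' (pure R A AM p X)) \<in> lin_hom R AM K"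
    by (rule lin_hom_compose[OF bilin_map_right[OF pure_bilin[OF A AM] p] L'_hom])
  show "(\<lambda>X. \<chi> p \<otimes>\<^bsub>R\<^esub> L X) \<in> lin_hom R AM K"
    using lin_hom_scale[OF K L_hom chi_closed[OF p]] by simp
qed (simp add: L'_pure_pure[OF p] L_pure)

text \<open>The functional seen by the summand of the product rule that differentiates the left
  factor: the \<open>M\<close> component is first moved past the right factor.\<close>

definition "L'' = assoc_right R A M A \<circ>> tensor_map R A AM id (braid R M A) \<circ>> L'"

lemma L''_hom: "L'' \<in> lin_hom R (tensor R AM A) K"
  unfolding L''_def
  by (rule lin_hom_fcomp[OF lin_hom_fcomp[OF assoc_right_hom[OF A M A]
          tensor_map_hom[OF A tensor_module[OF M A] A AM lin_hom_id braid_hom[OF M A]]] L'_hom])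

lemma L''_pure:
  assumes X: "X \<in> carrier AM" and v: "v \<in> carrier A"
  shows "L'' (pure R AM A X v) = \<chi> v \<otimes>\<^bsub>R\<^esub> L X"
proof (rule tensor_ext[OF A M K _ _ _ X])
  show "(\<lambda>X. L'' (pure R AM A X v)) \<in> lin_hom R AM K"
    by (rule lin_hom_compose[OF bilin_map_left[OF pure_bilin[OF AM A] v] L''_hom])
  show "(\<lambda>X. \<chi> v \<otimes>\<^bsub>R\<^esub> L X) \<in> lin_hom R AM K"
    using lin_hom_scale[OF K L_hom chi_closed[OF v]] by simp
  fix s m assume "s \<in> carrier A" "m \<in> carrier M"
  then show "L'' (pure R AM A (pure R A M s m) v) = \<chi> v \<otimes>\<^bsub>R\<^esub> L (pure R A M s m)"
    using v
    by (simp add: L''_def assoc_right_pure[OF A M A] braid_pure[OF M A] L'_pure_pure L_pure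
        tensor_map_pure[OF A tensor_module[OF M A] A AM lin_hom_id braid_hom[OF M A]]
        pure_closed[OF M A] chi_closed l_closed R.m_lcomm)
qed

text \<open>Apply \<open>L\<close> to the product rule at the pure tensor of \<open>u\<close> and
  \<open>v\<close>: the two summands are evaluated by \<open>L'\<close> and
  \<open>L''\<close>.\<close>

lemma E_mult:
  assumes u: "u \<in> carrier A" and v: "v \<in> carrier A"
  shows "E (u \<otimes>\<^bsub>A\<^esub> v) = \<chi> u \<otimes>\<^bsub>R\<^esub> E v \<oplus>\<^bsub>R\<^esub> \<chi> v \<otimes>\<^bsub>R\<^esub> E u"
proof -
  let ?x = "pure R A A u v"
  let ?y = "tensor_map R A AM id (b M) ?x" and ?z = "tensor_map R AM A (b M) id ?x"
  note y_hom = tensor_map_hom[OF A A A AM lin_hom_id b_hom[OF M]]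
  note y = tensor_map_pure[OF A A A AM lin_hom_id b_hom[OF M] u v]
  note z = tensor_map_pure[OF A A AM A b_hom[OF M] lin_hom_id u v]
  note closed = lin_hom_closed[OF b_hom[OF M]]
  have x: "?x \<in> carrier (tensor R A A)"
    using u v by (rule pure_closed[OF A A])
  have "E (u \<otimes>\<^bsub>A\<^esub> v) = L ((nabla \<circ>> b M) ?x)"
    using u v by (simp add: E_def nabla_pure)
  also have "\<dots> = L' (?y \<oplus>\<^bsub>tensor R A AM\<^esub>
      (assoc_right R A M A \<circ>> tensor_map R A AM id (braid R M A)) ?z)"
    using product_rule[OF M _ x] by (simp add: L'_def Diff_def)
  also have "\<dots> = L' ?y \<oplus>\<^bsub>R\<^esub> L'' ?z"
    using lin_hom_add[OF L'_hom lin_hom_closed[OF y_hom x] lin_hom_closed[OF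
          lin_hom_fcomp[OF assoc_right_hom[OF A M A]
            tensor_map_hom[OF A tensor_module[OF M A] A AM lin_hom_id braid_hom[OF M A]]]
          pure_closed[OF AM A closed[OF u] v]]]
    by (simp add: z L''_def)
  also have "\<dots> = \<chi> u \<otimes>\<^bsub>R\<^esub> E v \<oplus>\<^bsub>R\<^esub> \<chi> v \<otimes>\<^bsub>R\<^esub> E u"
    using u v by (simp add: y z L'_pure L''_pure closed E_def)
  finally show ?thesis .
qed

text \<open>The linear rule turns the generator into a pure tensor with first factor one, and \<chi>
  sends one to one.\<close>

lemma E_alpha:
  assumes m: "m \<in> carrier M"
  shows "E (Diff_gen R M 0 m) = l m"
proof -
  interpret A: algebra R A by (rule Diff_algebra[OF M])
  have "b M (Diff_gen R M 0 m) = pure R A M \<one>\<^bsub>A\<^esub> m"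
    using linear_rule[OF M m] by (simp add: Diff_def Diff_gen_def)
  then show ?thesis
    using m by (simp add: E_def L_pure chi_one l_closed)
qed

section \<open>The chain rule as an identity of scalars\<close>

text \<open>
  The linear map \<open>n \<mapsto> c n \<cdot> w\<close> sends \<open>e\<close> to \<open>w\<close>, so by naturality the value of \<open>b\<close> at the generator
  \<open>w\<close> of order 1 is a sum of tensors \<open>s \<otimes> r \<cdot> w\<close>. The chain rule thus makes \<open>E (D w)\<close> a multiple
  of \<open>E w\<close>.
\<close>

lemma E_D_eq_zero:
  fixes N :: "('r, 'a) obj"
  assumes w: "w \<in> carrier A" "E w = \<zero>\<^bsub>R\<^esub>"
    and N: "module R N" and c: "c \<in> lin_hom R N K" and e: "e \<in> carrier N" "c e = \<one>\<^bsub>R\<^esub>"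
  shows "E (Diff_D R M w) = \<zero>\<^bsub>R\<^esub>"
proof -
  interpret A: algebra R A by (rule Diff_algebra[OF M])
  let ?B = "Diff_obj R A" and ?C = "Diff_obj R N"
  note B = Diff_module[OF A] and C = Diff_module[OF N]
  note nu = Diff_nu_hom[OF M]
  note c_closed = lin_hom_closed[OF c, simplified]
  define f where "f n = c n \<odot>\<^bsub>A\<^esub> w" for n
  have f: "f \<in> lin_hom R N A"
    using w(1) by (intro lin_homI)
      (simp_all add: f_def c_closed lin_hom_add[OF c] lin_hom_smult[OF c]
        A.smult_l_distr A.smult_assoc1)
  have fe: "f e = w"
    using e w(1) by (simp add: f_def)
  note Tf = Diff_map_hom[OF N A f]
  \<comment> \<open>Order 1 is used because \<nu> sends the generator of order 1 with value w to D
    w.\<close>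
  let ?g = "Diff_gen R N (Suc 0) e" and ?x = "Diff_gen R A (Suc 0) w"
  have g: "?g \<in> carrier ?C" and x: "?x \<in> carrier ?B"
    using lin_hom_closed[OF Diff_gen_hom[OF N] e(1)] lin_hom_closed[OF Diff_gen_hom[OF A] w(1)] .
  have bx: "b A ?x = tensor_map R ?B A (T_map (Diff R) N A f) f (b N ?g)"
    using natural[OF N A f, of ?g] g Diff_map_gen[OF N A f e(1)]
    by (simp add: fe) (simp add: Diff_def)
  \<comment> \<open>The right-hand side of the chain rule, pulled back to Diff(N) \<otimes> N,
    becomes a linear functional there. Showing it zero on pure tensors kills it at
    \<open>b N ?g\<close>, whatever that element is.\<close>
  define F where "F = tensor_map R ?B A (T_map (Diff R) N A f) f
    \<circ>> tensor_map R A AM (T_nu (Diff R) M) (b M) \<circ>> L'"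
  have F_hom: "F \<in> lin_hom R (tensor R ?C N) K"
    unfolding F_def
    by (rule lin_hom_fcomp[OF lin_hom_fcomp[OF tensor_map_hom[OF C N B A Tf f]
            tensor_map_hom[OF B A A AM nu b_hom[OF M]]] L'_hom])
  have "E (Diff_D R M w) = L ((T_nu (Diff R) M \<circ>> b M) ?x)"
    using Diff_nu_gen[OF M w(1), of "Suc 0"] by (simp add: E_def)
  also have "\<dots> = F (b N ?g)"
    using chain_rule[OF M _, of A ?x] x by (simp add: F_def L'_def flip: bx) (simp add: Diff_def)
  also have "\<dots> = \<zero>\<^bsub>R\<^esub>"
  proof (rule tensor_ext[OF C N K F_hom _ _ lin_hom_closed[OF b_hom[OF N] g]])
    show "(\<lambda>x. \<zero>\<^bsub>R\<^esub>) \<in> lin_hom R (tensor R ?C N) K"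
      using lin_hom_null[OF K] by simp
    fix s n assume sn: "s \<in> carrier ?C" "n \<in> carrier N"
    have fn: "f n \<in> carrier A"
      using sn(2) by (rule lin_hom_closed[OF f])
    have "F (pure R ?C N s n) =
        \<chi> (T_nu (Diff R) M (T_map (Diff R) N A f s)) \<otimes>\<^bsub>R\<^esub> E (f n)"
      using sn fn
      by (simp add: F_def tensor_map_pure[OF C N B A Tf f]
          tensor_map_pure[OF B A A AM nu b_hom[OF M]]
          lin_hom_closed[OF Tf] lin_hom_closed[OF nu] lin_hom_closed[OF b_hom[OF M]] L'_pure E_def)
    \<comment> \<open>By linearity this is \<open>c n\<close> times \<open>E w\<close>; its
      vanishing makes the unknown value of \<chi> beside it irrelevant.\<close>
    also have "E (f n) = \<zero>\<^bsub>R\<^esub>"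
      using sn w by (simp add: f_def lin_hom_smult[OF E_hom w(1)] c_closed)
    finally show "F (pure R ?C N s n) = \<zero>\<^bsub>R\<^esub>"
      using sn by (simp add: chi_closed lin_hom_closed[OF Tf] lin_hom_closed[OF nu])
  qed
  finally show ?thesis .
qed

end

section \<open>The free module of rank two\<close>

text \<open>A scalar can enter \<open>elem\<close> only through \<open>Smult\<close>, as
  \<open>'a\<close> need not contain R. The constructors serve here as a mere container for two
  scalars.\<close>

definition pair :: "'r \<Rightarrow> 'r \<Rightarrow> ('r, 'a) elem"
  where "pair r q = Smult r (Smult q Zero)"

lemma pair_eq_iff [simp]: "pair r q = pair r' q' \<longleftrightarrow> r = r' \<and> q = q'"
  by (simp add: pair_def)

definition fst_coord :: "('r, 'a) elem \<Rightarrow> 'r"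
  where "fst_coord x = (THE r. \<exists>q. x = pair r q)"

definition snd_coord :: "('r, 'a) elem \<Rightarrow> 'r"
  where "snd_coord x = (THE q. \<exists>r. x = pair r q)"

lemma coord_pair [simp]: "fst_coord (pair r q) = r" "snd_coord (pair r q) = q"
  by (simp_all add: fst_coord_def snd_coord_def)

definition plane :: "('r, 'c) ring_scheme \<Rightarrow> ('r, 'a) obj"
  where "plane R =
    \<lparr>carrier = {pair r q |r q. r \<in> carrier R \<and> q \<in> carrier R}, mult = undefined, one = undefined,
     zero = pair \<zero>\<^bsub>R\<^esub> \<zero>\<^bsub>R\<^esub>,
     add = (\<lambda>x y. pair (fst_coord x \<oplus>\<^bsub>R\<^esub> fst_coord y) (snd_coord x \<oplus>\<^bsub>R\<^esub> snd_coord y)),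
     smult = (\<lambda>r x. pair (r \<otimes>\<^bsub>R\<^esub> fst_coord x) (r \<otimes>\<^bsub>R\<^esub> snd_coord x))\<rparr>"

lemma plane_simps [simp]:
  "carrier (plane R) = {pair r q |r q. r \<in> carrier R \<and> q \<in> carrier R}"
  "\<zero>\<^bsub>plane R\<^esub> = pair \<zero>\<^bsub>R\<^esub> \<zero>\<^bsub>R\<^esub>"
  "x \<oplus>\<^bsub>plane R\<^esub> y = pair (fst_coord x \<oplus>\<^bsub>R\<^esub> fst_coord y) (snd_coord x \<oplus>\<^bsub>R\<^esub> snd_coord y)"
  "r \<odot>\<^bsub>plane R\<^esub> x = pair (r \<otimes>\<^bsub>R\<^esub> fst_coord x) (r \<otimes>\<^bsub>R\<^esub> snd_coord x)"
  by (simp_all add: plane_def)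

lemma plane_module:
  assumes "cring R"
  shows "module R (plane R)"
proof -
  interpret R: cring R by fact
  have "abelian_group (plane R)"
  proof (rule abelian_groupI)
    fix x assume "x \<in> carrier (plane R)"
    then show "\<exists>y\<in>carrier (plane R). y \<oplus>\<^bsub>plane R\<^esub> x = \<zero>\<^bsub>plane R\<^esub>"
      by (intro bexI[of _ "pair (\<ominus>\<^bsub>R\<^esub> fst_coord x) (\<ominus>\<^bsub>R\<^esub> snd_coord x)"])
        (fastforce simp: R.l_neg)+
  qed (auto simp: R.a_ac)
  then show ?thesis
    by (intro moduleI) (auto simp: R.is_cring R.l_distr R.r_distr R.m_assoc)
qed

lemma fst_coord_hom: "fst_coord \<in> lin_hom R (plane R) (self_algebra R)"
  by (rule lin_homI) auto

lemma snd_coord_component_hom: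
  "(\<lambda>x. snd_coord (component x k)) \<in> lin_hom R (dsum (plane R)) (self_algebra R)"
  by (rule lin_homI) (fastforce dest: spec[of _ k])+

theorem theorem9p6:
  fixes R :: "('r, 'c) ring_scheme"
  assumes "cring R"
    and "\<one>\<^bsub>R\<^esub> \<noteq> \<zero>\<^bsub>R\<^esub>"
  shows "\<not> (\<exists>b :: ('r, 'a) obj \<Rightarrow> ('r, 'a) fn. deriving_transformation R (Diff R) b)"
proof
  assume "\<exists>b :: ('r, 'a) obj \<Rightarrow> ('r, 'a) fn. deriving_transformation R (Diff R) b"
  then obtain b :: "('r, 'a) obj \<Rightarrow> ('r, 'a) fn" where "deriving_transformation R (Diff R) b" ..
  \<comment> \<open>The first form reads the second coordinate at index 1: it defines the point with
    y' = 1 where x, y and all other derivatives vanish. The form \<open>fst_coord\<close> gives E(x)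
    = 1 and E(y) = 0.\<close>
  then interpret pointed_deriving_transformation R b "plane R"
    "\<lambda>x. snd_coord (component x (Suc 0))" fst_coord
    using plane_module[OF assms(1)] snd_coord_component_hom fst_coord_hom
    by (intro pointed_deriving_transformation.intro pointed_deriving_transformation_axioms.intro)
  interpret A: algebra R A by (rule Diff_algebra[OF M])
  define e\<^sub>1 e\<^sub>2 :: "('r, 'a) elem" where "e\<^sub>1 = pair \<one>\<^bsub>R\<^esub> \<zero>\<^bsub>R\<^esub>" and "e\<^sub>2 = pair \<zero>\<^bsub>R\<^esub> \<one>\<^bsub>R\<^esub>"
  have e: "e\<^sub>1 \<in> carrier (plane R)" "e\<^sub>2 \<in> carrier (plane R)"
    by (auto simp: e\<^sub>1_def e\<^sub>2_def)
  let ?x = "\<lambda>k. Diff_gen R (plane R) k e\<^sub>1" and ?y = "\<lambda>k. Diff_gen R (plane R) k e\<^sub>2"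
  have gens: "?x k \<in> carrier A" "?y k \<in> carrier A" for k
    using e by (auto intro: lin_hom_closed[OF Diff_gen_hom[OF M]] simp del: plane_simps)
  have chi: "\<chi> (?x k) = \<zero>\<^bsub>R\<^esub>" "\<chi> (?y k) = (if k = 1 then \<one>\<^bsub>R\<^esub> else \<zero>\<^bsub>R\<^esub>)" for k
    using e by (simp_all add: chi_gen dsum_in_def e\<^sub>1_def e\<^sub>2_def del: plane_simps(1))
  have E: "E (?x 0) = \<one>\<^bsub>R\<^esub>" "E (?y 0) = \<zero>\<^bsub>R\<^esub>"
    using e by (simp_all add: E_alpha e\<^sub>1_def e\<^sub>2_def del: plane_simps(1))
  have "E (?x 0 \<otimes>\<^bsub>A\<^esub> ?y 0) = \<zero>\<^bsub>R\<^esub>"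
    by (simp add: E_mult gens chi E)
  \<comment> \<open>The plane also serves as the auxiliary module, with \<open>fst_coord\<close>
    taking the value 1 at \<open>e\<^sub>1\<close>.\<close>
  then have "E (Diff_D R (plane R) (?x 0 \<otimes>\<^bsub>A\<^esub> ?y 0)) = \<zero>\<^bsub>R\<^esub>"
    using E_D_eq_zero[OF _ _ M fst_coord_hom e(1)] gens by (simp add: e\<^sub>1_def)
  moreover have "Diff_D R (plane R) (?x 0 \<otimes>\<^bsub>A\<^esub> ?y 0) = ?x 1 \<otimes>\<^bsub>A\<^esub> ?y 0 \<oplus>\<^bsub>A\<^esub> ?x 0 \<otimes>\<^bsub>A\<^esub> ?y 1"
    using e by (simp add: Diff_D_mult[OF M] Diff_D_gen[OF M] gens del: plane_simps)
  \<comment> \<open>The unknown values E(x') and E(y') occur only with the factors \<chi>(y) = 0 and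
    \<chi>(x) = 0; what survives is \<chi>(y') E(x) = 1.\<close>
  moreover have "E \<dots> = \<one>\<^bsub>R\<^esub>"
    by (simp add: lin_hom_add[OF E_hom] gens E_mult chi E E_closed)
  ultimately show False
    using assms(2) by simp
qed

end
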